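(* Let $n\ge 1$ and let $H:\mathbb{R}^n\times\mathbb{R}^n\to\mathbb{R}$ be a Hamiltonian satisfying conditions (i)--(iv) listed in the context, with recession function $H_\infty$. Then $H$ is uniquely ergodic if and only if both of the following assertions hold: (Structural equicontinuity) for every continuous and $\mathbb{Z}^n$-periodic function $g:\mathbb{R}^n\to\mathbb{R}$, if for each $\delta>0$ $u_\delta$ denotes the continuous viscosity solution of $$\delta u(x)+g(x)+H(x,Du(x))=0\ \text{ in }\mathbb{R}^n,\qquad u\ \ \mathbb{Z}^n\text{-periodic},$$ then the family $\{\delta u_\delta\}_{0<\delta\le 1}$ is equicontinuous; (Strong maximum principle) the constant functions are the only continuous viscosity solutions of $$H_\infty(x,Dw(x))=0\ \text{ in }\mathbb{R}^n,\qquad w\ \ \mathbb{Z}^n\text{-periodic}.$$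
   Context: $|\cdot|$ is the Euclidean norm. A modulus of continuity is a nondecreasing function $\omega:[0,+\infty)\to[0,+\infty)$ with $\lim_{r\to0}\omega(r)=\omega(0)=0$. Conditions on $H$: (i) $H$ is continuous; (ii) $H(x+k,p)=H(x,p)$ for all $x,p\in\mathbb{R}^n$, $k\in\mathbb{Z}^n$; (iii) there is a modulus of continuity $\omega$ such that $|H(x,p)-H(y,p)|\le\omega(|x-y|(1+|p|))$ for all $x,y,p\in\mathbb{R}^n$; (iv) there are a function $H_\infty:\mathbb{R}^n\times\mathbb{R}^n\to\mathbb{R}$, positively homogeneous of degree one in the second variable (i.e. $H_\infty(x,\nu p)=\nu H_\infty(x,p)$ for all $x,p$ and $\nu>0$), and a constant $M_H\ge0$ such that $|H(x,p)-H_\infty(x,p)|\le M_H$ for all $x,p\in\mathbb{R}^n$. The function $H_\infty$ is necessarily unique and is called the recession function of $H$. Under (i)--(iii), for every $\delta>0$ the problem $\delta u(x)+H(x,Du(x))=0$ in $\mathbb{R}^n$, $u$ $\mathbb{Z}^n$-periodic, has a unique continuous viscosity solution. A Hamiltonian $H$ satisfying (i)--(iii) is ergodic if, denoting by $u_\delta$ this solution, $\delta u_\delta(x)$ converges uniformly in $x$ to a constant as $\delta\to0$ (equivalently, by a known result, if $u(t,x)/t$ converges uniformly in $x$ to a constant as $t\to+\infty$, where $u$ is the continuous viscosity solution of $\partial_tu+H(x,Du)=0$ in $(0,+\infty)\times\mathbb{R}^n$, $u(0,\cdot)=0$, $u(t,\cdot)$ $\mathbb{Z}^n$-periodic). $H$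 is uniquely ergodic if for every continuous $\mathbb{Z}^n$-periodic $g:\mathbb{R}^n\to\mathbb{R}$, the Hamiltonian $(x,p)\mapsto g(x)+H(x,p)$ is ergodic. *)

theory Defs
  imports "HOL-Analysis.Analysis"
begin

text \<open>
  An equation \<open>F(x, u(x), Du(x)) = 0\<close> on the whole space is given by \<open>F\<close>. Test functions
  are \<open>C\<^sup>1\<close>, given together with their continuous gradient field \<open>D\<phi>\<close>.
\<close>

definition viscosity_subsolution ::
    "('a::euclidean_space \<Rightarrow> real \<Rightarrow> 'a \<Rightarrow> real) \<Rightarrow> ('a \<Rightarrow> real) \<Rightarrow> bool" where
  "viscosity_subsolution F u \<longleftrightarrow>
     (\<forall>\<phi> D\<phi> x. (\<forall>y. GDERIV \<phi> y :> D\<phi> y) \<longrightarrow> continuous_on UNIV D\<phi> \<longrightarrow>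
        (\<forall>\<^sub>F y in nhds x. u y - \<phi> y \<le> u x - \<phi> x) \<longrightarrow> F x (u x) (D\<phi> x) \<le> 0)"

definition viscosity_supersolution ::
    "('a::euclidean_space \<Rightarrow> real \<Rightarrow> 'a \<Rightarrow> real) \<Rightarrow> ('a \<Rightarrow> real) \<Rightarrow> bool" where
  "viscosity_supersolution F u \<longleftrightarrow>
     (\<forall>\<phi> D\<phi> x. (\<forall>y. GDERIV \<phi> y :> D\<phi> y) \<longrightarrow> continuous_on UNIV D\<phi> \<longrightarrow>
        (\<forall>\<^sub>F y in nhds x. u y - \<phi> y \<ge> u x - \<phi> x) \<longrightarrow> F x (u x) (D\<phi> x) \<ge> 0)"

definition continuous_viscosity_solution ::
    "('a::euclidean_space \<Rightarrow> real \<Rightarrow> 'a \<Rightarrow> real) \<Rightarrow> ('a \<Rightarrow> real) \<Rightarrow> bool" where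
  "continuous_viscosity_solution F u \<longleftrightarrow>
     continuous_on UNIV u \<and> viscosity_subsolution F u \<and> viscosity_supersolution F u"

definition int_periodic :: "(real ^ 'n \<Rightarrow> 'b) \<Rightarrow> bool" where
  "int_periodic f \<longleftrightarrow> (\<forall>x k. (\<forall>i. k $ i \<in> \<int>) \<longrightarrow> f (x + k) = f x)"

text \<open>Only the values of \<open>\<omega>\<close> on the half-line \<open>[0, \<infinity>)\<close> matter.\<close>

definition modulus_of_continuity :: "(real \<Rightarrow> real) \<Rightarrow> bool" where
  "modulus_of_continuity \<omega> \<longleftrightarrow>
     mono_on {0..} \<omega> \<and> (\<forall>r\<ge>0. \<omega> r \<ge> 0) \<and> \<omega> 0 = 0 \<and> (\<omega> \<longlongrightarrow> 0) (at_right 0)"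

definition hamiltonian :: "(real ^ 'n \<Rightarrow> real ^ 'n \<Rightarrow> real) \<Rightarrow> bool" where
  "hamiltonian H \<longleftrightarrow>
     continuous_on UNIV (\<lambda>(x, p). H x p) \<and>
     int_periodic H \<and>
     (\<exists>\<omega>. modulus_of_continuity \<omega> \<and>
        (\<forall>x y p. \<bar>H x p - H y p\<bar> \<le> \<omega> (norm (x - y) * (1 + norm p))))"

definition recession_function ::
    "(real ^ 'n \<Rightarrow> real ^ 'n \<Rightarrow> real) \<Rightarrow> (real ^ 'n \<Rightarrow> real ^ 'n \<Rightarrow> real) \<Rightarrow> bool" where
  "recession_function H Hinf \<longleftrightarrow>
     (\<forall>x p. \<forall>\<nu>>0. Hinf x (\<nu> *\<^sub>R p) = \<nu> * Hinf x p) \<and>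
     (\<exists>M\<ge>0. \<forall>x p. \<bar>H x p - Hinf x p\<bar> \<le> M)"

definition discounted_solution ::
    "(real ^ 'n \<Rightarrow> real ^ 'n \<Rightarrow> real) \<Rightarrow> real \<Rightarrow> (real ^ 'n \<Rightarrow> real) \<Rightarrow> bool" where
  "discounted_solution H \<delta> u \<longleftrightarrow>
     continuous_viscosity_solution (\<lambda>x r p. \<delta> * r + H x p) u \<and> int_periodic u"

text \<open>
  For a Hamiltonian and \<open>\<delta> > 0\<close> there is exactly one \<open>u\<close> with \<open>discounted_solution H \<delta> u\<close>. Hence
  there is exactly one choice of \<open>u \<delta>\<close> for \<open>\<delta> > 0\<close> below; the values of \<open>u\<close> at \<open>\<delta> \<le> 0\<close> are
  irrelevant.
\<close>

definition ergodic :: "(real ^ 'n \<Rightarrow> real ^ 'n \<Rightarrow> real) \<Rightarrow> bool" where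
  "ergodic H \<longleftrightarrow>
     (\<forall>u. (\<forall>\<delta>>0. discounted_solution H \<delta> (u \<delta>)) \<longrightarrow>
        (\<exists>c. uniform_limit UNIV (\<lambda>\<delta> x. \<delta> * u \<delta> x) (\<lambda>_. c) (at_right 0)))"

definition uniquely_ergodic :: "(real ^ 'n \<Rightarrow> real ^ 'n \<Rightarrow> real) \<Rightarrow> bool" where
  "uniquely_ergodic H \<longleftrightarrow>
     (\<forall>g. continuous_on UNIV g \<longrightarrow> int_periodic g \<longrightarrow> ergodic (\<lambda>x p. g x + H x p))"

definition equicontinuous :: "('a::metric_space \<Rightarrow> 'b::metric_space) set \<Rightarrow> bool" where
  "equicontinuous \<F> \<longleftrightarrow>
     (\<forall>x. \<forall>\<epsilon>>0. \<exists>\<eta>>0. \<forall>f\<in>\<F>. \<forall>y. dist y x < \<eta> \<longrightarrow> dist (f y) (f x) < \<epsilon>)"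

definition structural_equicontinuity :: "(real ^ 'n \<Rightarrow> real ^ 'n \<Rightarrow> real) \<Rightarrow> bool" where
  "structural_equicontinuity H \<longleftrightarrow>
     (\<forall>g. continuous_on UNIV g \<longrightarrow> int_periodic g \<longrightarrow>
        (\<forall>u. (\<forall>\<delta>>0. discounted_solution (\<lambda>x p. g x + H x p) \<delta> (u \<delta>)) \<longrightarrow>
           equicontinuous {\<lambda>x. \<delta> * u \<delta> x | \<delta>. 0 < \<delta> \<and> \<delta> \<le> 1}))"

definition strong_maximum_principle :: "(real ^ 'n \<Rightarrow> real ^ 'n \<Rightarrow> real) \<Rightarrow> bool" where
  "strong_maximum_principle Hinf \<longleftrightarrow>
     (\<forall>w. continuous_viscosity_solution (\<lambda>x r p. Hinf x p) w \<and> int_periodic w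
        \<longleftrightarrow> (\<exists>c. w = (\<lambda>_. c)))"

end

theory Submission
  imports Defs "HOL-Complex_Analysis.Great_Picard"
begin

text \<open>
  Three facts carry the proof.

  \<^item> Comparison (\<open>comparison_at_max\<close>). Let \<open>u\<close> be a periodic subsolution of \<open>a(x, u) + H(x, Du) = 0\<close>
    and \<open>w\<close> a periodic supersolution of \<open>b(x, w) + H(x, Dw) = 0\<close>. Then \<open>a(x, u(x)) \<le> b(x, w(x))\<close> at
    some maximum \<open>x\<close> of \<open>u - w\<close>. This is doubling of variables on the compact torus.

  \<^item> Existence (\<open>discounted_solution_exists\<close>). Perron's method produces the functions \<open>u\<^sub>\<delta>\<close>. The strong
    maximum principle depends on it, because it is deduced from the behaviour of these functions.

  \<^item> Stability (\<open>discounted_limit_solution\<close>). The function \<open>v\<^sub>\<delta> = \<delta>u\<^sub>\<delta>\<close> solves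
    \<open>\<delta>(v\<^sub>\<delta> + g) + \<delta>H(x, Dv\<^sub>\<delta>/\<delta>) = 0\<close>, and \<open>\<delta>H(x, p/\<delta>)\<close> is within \<open>\<delta>M\<close> of \<open>H\<^sub>\<infinity>(x, p)\<close>. Hence uniform limits
    of \<open>v\<^sub>\<delta>\<close> as \<open>\<delta> \<rightarrow> 0\<close> solve \<open>H\<^sub>\<infinity>(x, Dw) = 0\<close>.

  Suppose that \<open>H\<close> is uniquely ergodic. The family \<open>v\<^sub>\<delta>\<close> is continuous in \<open>\<delta> > 0\<close> for the uniform norm and
  has a constant uniform limit at \<open>\<delta> = 0\<close>, so it is equicontinuous. If \<open>w\<close> solves \<open>H\<^sub>\<infinity>(x, Dw) = 0\<close>,
  then by homogeneity \<open>Kw/\<delta>\<close> solves the discounted equation with source \<open>g = -Kw\<close> up to an error \<open>M\<close>.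
  Comparison gives \<open>\<bar>v\<^sub>\<delta> - Kw\<bar> \<le> M\<close>; as \<open>v\<^sub>\<delta>\<close> tends to a constant, \<open>K\<close> times the oscillation of \<open>w\<close> is at
  most \<open>2M\<close> for every \<open>K\<close>, and \<open>w\<close> is constant.

  Conversely, equicontinuity and the Arzela--Ascoli theorem yield uniform limits of \<open>v\<^sub>\<delta>\<close> along
  sequences \<open>\<delta> \<rightarrow> 0\<close>. They solve \<open>H\<^sub>\<infinity>(x, Dw) = 0\<close> and are constant by the strong maximum principle, so the
  oscillation of \<open>v\<^sub>\<delta>\<close> tends to \<open>0\<close>. Comparing two parameters gives a point where the first value
  does not exceed the second, and the reverse elsewhere; hence the constants agree.
\<close>

section \<open>Upper semicontinuity\<close>

definition usc :: "('a::topological_space \<Rightarrow> real) \<Rightarrow> bool" where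
  "usc u \<longleftrightarrow> (\<forall>c. open {x. u x < c})"

lemma continuous_imp_usc:
  assumes "continuous_on UNIV u"
  shows "usc u"
  unfolding usc_def using assms by (auto intro!: open_Collect_less continuous_intros)

lemma usc_add:
  assumes "usc u" "usc v"
  shows "usc (\<lambda>x. u x + v x)"
proof -
  have "{x. u x + v x < c} = (\<Union>q. {x. u x < q} \<inter> {x. v x < c - q})" for c
  proof (intro set_eqI iffI)
    fix x assume "x \<in> {x. u x + v x < c}"
    then have "x \<in> {x. u x < (u x + (c - v x)) / 2} \<inter> {x. v x < c - (u x + (c - v x)) / 2}"
      by (simp add: field_simps)
    then show "x \<in> (\<Union>q. {x. u x < q} \<inter> {x. v x < c - q})" by blast
  qed auto
  moreover have "open (\<Union>q. {x. u x < q} \<inter> {x. v x < c - q})" for c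
    using assms unfolding usc_def by (intro open_UN ballI open_Int) blast+
  ultimately show ?thesis unfolding usc_def by simp
qed

lemma usc_compose:
  assumes "usc u" "continuous_on UNIV f"
  shows "usc (\<lambda>x. u (f x))"
  unfolding usc_def
proof
  fix c
  have "open (f -` {x. u x < c})" using assms unfolding usc_def by (intro open_vimage) auto
  then show "open {x. u (f x) < c}" by (simp add: vimage_def)
qed

lemma usc_eventually_less:
  assumes "usc u" "u x < c"
  shows "\<forall>\<^sub>F y in nhds x. u y < c"
  using assms unfolding usc_def eventually_nhds by blast

lemma usc_eventually_less_sequentially:
  assumes "usc u" "z \<longlonglongrightarrow> x" "u x < c"
  shows "\<forall>\<^sub>F n in sequentially. u (z n) < c"
  using eventually_compose_filterlim[OF usc_eventually_less[OF assms(1,3)] assms(2)] .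

lemma usc_attains_max:
  assumes "usc u" "compact K" "K \<noteq> {}"
  obtains x where "x \<in> K" "\<And>y. y \<in> K \<Longrightarrow> u y \<le> u x"
proof (rule ccontr)
  assume *: "\<not> thesis"
  then have "K \<subseteq> (\<Union>x\<in>K. {y. u y < u x})"
    using that by (fastforce simp: not_le)
  then obtain D where D: "D \<subseteq> K" "finite D" "K \<subseteq> (\<Union>x\<in>D. {y. u y < u x})"
    using compactE_image[OF assms(2), of K "\<lambda>x. {y. u y < u x}"] assms(1)
    unfolding usc_def by blast
  then have "D \<noteq> {}" using assms(3) by auto
  define m where "m = Max (u ` D)"
  have "m \<in> u ` D" unfolding m_def using D \<open>D \<noteq> {}\<close> by simp
  then obtain x where "x \<in> D" "u x = m" by auto
  moreover obtain x' where "x' \<in> D" "u x < u x'" using D \<open>x \<in> D\<close> by blast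
  moreover have "u x' \<le> m" unfolding m_def using D \<open>x' \<in> D\<close> by simp
  ultimately show False by simp
qed

text \<open>The least upper semicontinuous majorant of a bounded function.\<close>

definition usc_envelope :: "('a::topological_space \<Rightarrow> real) \<Rightarrow> 'a \<Rightarrow> real" where
  "usc_envelope u x = Inf {c. \<forall>\<^sub>F y in nhds x. u y < c}"

lemma usc_envelope_le:
  assumes "\<forall>\<^sub>F y in nhds x. u y < c"
  shows "usc_envelope u x \<le> c"
  unfolding usc_envelope_def
proof (rule cInf_lower)
  show "bdd_below {c. \<forall>\<^sub>F y in nhds x. u y < c}"
    by (rule bdd_belowI[of _ "u x"]) (auto dest: eventually_nhds_x_imp_x)
qed (use assms in simp)

lemma usc_envelope_lessD:
  assumes "\<And>y. u y \<le> b" "usc_envelope u x < c"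
  shows "\<exists>c'<c. \<forall>\<^sub>F y in nhds x. u y < c'"
proof -
  have "u y < b + 1" for y using assms(1)[of y] by simp
  then have "b + 1 \<in> {c. \<forall>\<^sub>F y in nhds x. u y < c}" by simp
  then have "{c. \<forall>\<^sub>F y in nhds x. u y < c} \<noteq> {}" by blast
  from cInf_lessD[OF this] assms(2) show ?thesis
    unfolding usc_envelope_def by blast
qed

lemma usc_envelope_ge:
  assumes "\<And>y. u y \<le> b"
  shows "u x \<le> usc_envelope u x"
proof (rule ccontr)
  assume "\<not> ?thesis"
  then have "usc_envelope u x < u x" by simp
  from usc_envelope_lessD[OF assms this] show False
    by (auto dest: eventually_nhds_x_imp_x)
qed

lemma usc_usc_envelope:
  assumes "\<And>y. u y \<le> b"
  shows "usc (usc_envelope u)"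
  unfolding usc_def
proof (rule allI, subst open_subopen, rule ballI)
  fix c x assume "x \<in> {x. usc_envelope u x < c}"
  then obtain c' where "c' < c" "\<forall>\<^sub>F y in nhds x. u y < c'"
    using usc_envelope_lessD[of u b x c, OF assms] by auto
  then obtain T where "open T" "x \<in> T" and T: "\<And>y. y \<in> T \<Longrightarrow> u y < c'"
    unfolding eventually_nhds by blast
  moreover have "usc_envelope u y < c" if "y \<in> T" for y
  proof -
    have "\<forall>\<^sub>F z in nhds y. u z < c'"
      unfolding eventually_nhds using \<open>open T\<close> T that by blast
    then show ?thesis using usc_envelope_le \<open>c' < c\<close> by fastforce
  qed
  ultimately show "\<exists>T. open T \<and> x \<in> T \<and> T \<subseteq> {x. usc_envelope u x < c}" by blast
qed

lemma usc_envelope_least: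
  assumes "usc v" "\<And>y. u y \<le> v y"
  shows "usc_envelope u x \<le> v x"
proof (rule dense_ge)
  fix c assume "v x < c"
  from usc_eventually_less[OF assms(1) this] have "\<forall>\<^sub>F y in nhds x. u y < c"
    by eventually_elim (rule le_less_trans[OF assms(2)])
  then show "usc_envelope u x \<le> c" by (rule usc_envelope_le)
qed

lemma usc_envelope_approx:
  assumes "c < usc_envelope u x" "\<forall>\<^sub>F y in nhds x. P y"
  shows "\<exists>y. P y \<and> c < u y"
proof (rule ccontr)
  assume *: "\<not> ?thesis"
  obtain c' where c': "c < c'" "c' < usc_envelope u x" using assms(1) dense by blast
  have "\<forall>\<^sub>F y in nhds x. u y < c'"
    using assms(2) by eventually_elim (use * c' in force)
  then show False using usc_envelope_le c' by fastforce
qed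

lemma usc_envelope_translation:
  fixes u :: "'a::real_normed_vector \<Rightarrow> real"
  assumes "\<And>y. u y \<le> b" "\<And>y. u (y + k) = u y"
  shows "usc_envelope u (x + k) = usc_envelope u x"
proof -
  have *: "usc_envelope u x \<le> usc_envelope u (x + h)" if "\<And>y. u (y + h) = u y" for x h
  proof (rule usc_envelope_least)
    show "usc (\<lambda>x. usc_envelope u (x + h))"
      by (rule usc_compose[OF usc_usc_envelope[of u b, OF assms(1)]]) (intro continuous_intros)
    show "u y \<le> usc_envelope u (y + h)" for y
      using usc_envelope_ge[of u b "y + h", OF assms(1)] that by simp
  qed
  have "u (y + - k) = u y" for y using assms(2)[of "y + - k"] by simp
  from *[of "- k" "x + k", OF this] *[of k x, OF assms(2)] show ?thesis by simp
qed

section \<open>Test functions\<close>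

definition test_function :: "('a::euclidean_space \<Rightarrow> real) \<Rightarrow> ('a \<Rightarrow> 'a) \<Rightarrow> bool" where
  "test_function \<phi> D\<phi> \<longleftrightarrow> (\<forall>y. GDERIV \<phi> y :> D\<phi> y) \<and> continuous_on UNIV D\<phi>"

lemma test_function_continuous: "test_function \<phi> D\<phi> \<Longrightarrow> continuous_on UNIV \<phi>"
  unfolding test_function_def gderiv_def
  by (intro has_derivative_continuous_on) auto

lemma test_function_const: "test_function (\<lambda>x. c) (\<lambda>x. 0)"
  unfolding test_function_def by (auto intro: GDERIV_const)

lemma test_function_add:
  assumes "test_function \<phi> D\<phi>" "test_function \<psi> D\<psi>"
  shows "test_function (\<lambda>x. \<phi> x + \<psi> x) (\<lambda>x. D\<phi> x + D\<psi> x)"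
  using assms unfolding test_function_def by (auto intro: GDERIV_add continuous_intros)

lemma test_function_scale:
  assumes "test_function \<phi> D\<phi>"
  shows "test_function (\<lambda>x. c * \<phi> x) (\<lambda>x. c *\<^sub>R D\<phi> x)"
  using assms unfolding test_function_def gderiv_def
  by (auto intro!: continuous_intros derivative_eq_intros)

lemma test_function_minus:
  assumes "test_function \<phi> D\<phi>"
  shows "test_function (\<lambda>x. - \<phi> x) (\<lambda>x. - D\<phi> x)"
  using test_function_scale[OF assms, of "-1"] by simp

lemma test_function_norm_square:
  "test_function (\<lambda>x. (norm (x - z))\<^sup>2) (\<lambda>x. 2 *\<^sub>R (x - z))"
  unfolding test_function_def gderiv_def power2_norm_eq_inner
  by (auto intro!: continuous_intros derivative_eq_intros simp: inner_commute algebra_simps)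

lemma test_function_quadratic:
  "test_function (\<lambda>x. c / 2 * (norm (x - z))\<^sup>2) (\<lambda>x. c *\<^sub>R (x - z))"
  using test_function_scale[OF test_function_norm_square, of "c / 2" z] by simp

lemma gradient_eq_0_at_local_max:
  assumes "test_function \<phi> D\<phi>" "\<forall>\<^sub>F y in nhds x. \<phi> y \<le> \<phi> x"
  shows "D\<phi> x = 0"
proof -
  obtain S where "open S" "x \<in> S" "\<forall>y\<in>S. \<phi> y \<le> \<phi> x"
    using assms(2) unfolding eventually_nhds by blast
  moreover have "(\<phi> has_derivative (\<lambda>h. h \<bullet> D\<phi> x)) (at x)"
    using assms(1) unfolding test_function_def gderiv_def by blast
  ultimately have "(\<lambda>h. h \<bullet> D\<phi> x) = (\<lambda>v. 0)"
    using differential_zero_maxmin by blast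
  then have "D\<phi> x \<bullet> D\<phi> x = 0" by metis
  then show ?thesis by simp
qed

lemma subsolutionI:
  assumes "\<And>\<phi> D\<phi> x. test_function \<phi> D\<phi> \<Longrightarrow> \<forall>\<^sub>F y in nhds x. u y - \<phi> y \<le> u x - \<phi> x \<Longrightarrow>
    F x (u x) (D\<phi> x) \<le> 0"
  shows "viscosity_subsolution F u"
  using assms unfolding viscosity_subsolution_def test_function_def by blast

lemma subsolutionD:
  assumes "viscosity_subsolution F u" "test_function \<phi> D\<phi>"
    "\<forall>\<^sub>F y in nhds x. u y - \<phi> y \<le> u x - \<phi> x"
  shows "F x (u x) (D\<phi> x) \<le> 0"
  using assms unfolding viscosity_subsolution_def test_function_def by blast

lemma supersolutionD:
  assumes "viscosity_supersolution F u" "test_function \<phi> D\<phi>"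
    "\<forall>\<^sub>F y in nhds x. u y - \<phi> y \<ge> u x - \<phi> x"
  shows "F x (u x) (D\<phi> x) \<ge> 0"
  using assms unfolding viscosity_supersolution_def test_function_def by blast

lemma supersolutionI:
  assumes "\<And>\<phi> D\<phi> x. test_function \<phi> D\<phi> \<Longrightarrow> \<forall>\<^sub>F y in nhds x. u y - \<phi> y \<ge> u x - \<phi> x \<Longrightarrow>
    F x (u x) (D\<phi> x) \<ge> 0"
  shows "viscosity_supersolution F u"
  using assms unfolding viscosity_supersolution_def test_function_def by blast

text \<open>
  Reflecting the unknown exchanges the two kinds of solution, so that only subsolutions have to
  be treated in what is symmetric.
\<close>

lemma supersolution_iff_subsolution_uminus:
  "viscosity_supersolution F u \<longleftrightarrow>
     viscosity_subsolution (\<lambda>x r p. - F x (- r) (- p)) (\<lambda>x. - u x)"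
proof
  assume *: "viscosity_supersolution F u"
  show "viscosity_subsolution (\<lambda>x r p. - F x (- r) (- p)) (\<lambda>x. - u x)"
  proof (rule subsolutionI)
    fix \<phi> D\<phi> x assume "test_function \<phi> D\<phi>" "\<forall>\<^sub>F y in nhds x. - u y - \<phi> y \<le> - u x - \<phi> x"
    with supersolutionD[OF * test_function_minus, of \<phi> D\<phi> x]
    show "- F x (- (- u x)) (- D\<phi> x) \<le> 0" by (simp add: algebra_simps)
  qed
next
  assume *: "viscosity_subsolution (\<lambda>x r p. - F x (- r) (- p)) (\<lambda>x. - u x)"
  show "viscosity_supersolution F u"
  proof (rule supersolutionI)
    fix \<phi> D\<phi> x assume "test_function \<phi> D\<phi>" "\<forall>\<^sub>F y in nhds x. u y - \<phi> y \<ge> u x - \<phi> x"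
    with subsolutionD[OF * test_function_minus, of \<phi> D\<phi> x]
    show "F x (u x) (D\<phi> x) \<ge> 0" by (simp add: algebra_simps)
  qed
qed

lemma subsolution_const:
  assumes "\<And>x. F x c 0 \<le> 0"
  shows "viscosity_subsolution F (\<lambda>x. c)"
proof (rule subsolutionI)
  fix \<phi> D\<phi> and x :: 'a assume "test_function \<phi> D\<phi>" "\<forall>\<^sub>F y in nhds x. c - \<phi> y \<le> c - \<phi> x"
  with gradient_eq_0_at_local_max[OF test_function_minus, of \<phi> D\<phi> x]
  show "F x c (D\<phi> x) \<le> 0" using assms by simp
qed

lemma supersolution_const:
  assumes "\<And>x. F x c 0 \<ge> 0"
  shows "viscosity_supersolution F (\<lambda>x. c)"
  unfolding supersolution_iff_subsolution_uminus using assms by (intro subsolution_const) simp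

section \<open>Stability under relaxed limits\<close>

text \<open>
  The gradient of a test function at a contact point of a limit is itself a limit of gradients
  at contact points of the approximations.
  Adding \<open>|y - x0|\<^sup>2\<close> to the test function makes the local maximum of the limit strict. The maxima of
  the approximations over a small closed ball then have to converge to \<open>x0\<close>, and they
  carry the values along.
\<close>

lemma relaxed_limit_contact_points:
  fixes u :: "nat \<Rightarrow> 'a::euclidean_space \<Rightarrow> real"
  assumes \<phi>: "test_function \<phi> D\<phi>" "\<forall>\<^sub>F y in nhds x0. U y - \<phi> y \<le> U x0 - \<phi> x0"
    and usc: "\<And>n. usc (u n)" and le: "\<And>n y. u n y \<le> U y + e n" and e: "e \<longlonglongrightarrow> 0"
    and y: "y \<longlonglongrightarrow> x0" "(\<lambda>n. u n (y n)) \<longlonglongrightarrow> U x0"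
  obtains z \<psi> D\<psi> where "test_function \<psi> D\<psi>" "z \<longlonglongrightarrow> x0" "(\<lambda>n. u n (z n)) \<longlonglongrightarrow> U x0"
    "(\<lambda>n. D\<psi> (z n)) \<longlonglongrightarrow> D\<phi> x0"
    "\<forall>\<^sub>F n in sequentially. \<forall>\<^sub>F y in nhds (z n). u n y - \<psi> y \<le> u n (z n) - \<psi> (z n)"
proof -
  define \<psi> where "\<psi> = (\<lambda>y. \<phi> y + (norm (y - x0))\<^sup>2)"
  define D\<psi> where "D\<psi> = (\<lambda>y. D\<phi> y + 2 *\<^sub>R (y - x0))"
  have \<psi>: "test_function \<psi> D\<psi>"
    unfolding \<psi>_def D\<psi>_def by (intro test_function_add \<phi> test_function_norm_square)
  obtain s where "s > 0" and s: "\<And>y. dist y x0 < s \<Longrightarrow> U y - \<phi> y \<le> U x0 - \<phi> x0"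
    using \<phi>(2) unfolding eventually_nhds_metric by blast
  define r where "r = s / 2"
  have r: "r > 0" and rle: "\<And>y. y \<in> cball x0 r \<Longrightarrow> U y - \<phi> y \<le> U x0 - \<phi> x0"
    using s \<open>s > 0\<close> unfolding r_def by (auto simp: dist_commute)
  have cont: "continuous_on UNIV \<psi>" "continuous_on UNIV \<phi>"
    using \<psi> \<phi> test_function_continuous by blast+
  have "\<exists>z\<in>cball x0 r. \<forall>y\<in>cball x0 r. u n y - \<psi> y \<le> u n z - \<psi> z" for n
  proof -
    have "usc (\<lambda>y. - \<psi> y)"
      by (rule continuous_imp_usc) (intro continuous_intros cont)
    from usc_add[OF usc[of n] this] have "usc (\<lambda>y. u n y + - \<psi> y)" .
    moreover have "cball x0 r \<noteq> {}" using r by simp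
    ultimately obtain z where "z \<in> cball x0 r"
      "\<And>y. y \<in> cball x0 r \<Longrightarrow> u n y + - \<psi> y \<le> u n z + - \<psi> z"
      using usc_attains_max[OF _ compact_cball] by blast
    then show ?thesis by (intro bexI[of _ z] ballI) simp_all
  qed
  then obtain z where z: "\<And>n. z n \<in> cball x0 r"
    "\<And>n y. y \<in> cball x0 r \<Longrightarrow> u n y - \<psi> y \<le> u n (z n) - \<psi> (z n)" by metis
  have \<psi>0: "\<psi> x0 = \<phi> x0" by (simp add: \<psi>_def)
  define m where "m n = u n (z n) - \<psi> (z n)" for n
  have up: "m n \<le> U x0 - \<phi> x0 + e n - (norm (z n - x0))\<^sup>2" for n
    using le[of n "z n"] rle[OF z(1), of n] unfolding m_def \<psi>_def by simp
  have lo: "\<forall>\<^sub>F n in sequentially. u n (y n) - \<psi> (y n) \<le> m n"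
  proof -
    have "\<forall>\<^sub>F n in sequentially. y n \<in> ball x0 r"
      using y(1) r by (metis centre_in_ball open_ball topological_tendstoD)
    then show ?thesis by eventually_elim (auto simp: m_def intro!: z(2))
  qed
  have \<psi>y: "(\<lambda>n. u n (y n) - \<psi> (y n)) \<longlonglongrightarrow> U x0 - \<phi> x0"
    using tendsto_diff[OF y(2) continuous_on_tendsto_compose[OF cont(1) y(1)]] \<psi>0 by simp
  have mlim: "m \<longlonglongrightarrow> U x0 - \<phi> x0"
  proof (rule tendsto_sandwich[OF lo _ \<psi>y])
    show "\<forall>\<^sub>F n in sequentially. m n \<le> U x0 - \<phi> x0 + e n"
      by (intro always_eventually allI order_trans[OF up]) simp
    show "(\<lambda>n. U x0 - \<phi> x0 + e n) \<longlonglongrightarrow> U x0 - \<phi> x0"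
      using tendsto_add[OF tendsto_const e, of "U x0 - \<phi> x0"] by simp
  qed
  have "(\<lambda>n. (norm (z n - x0))\<^sup>2) \<longlonglongrightarrow> 0"
  proof (rule tendsto_sandwich[where f = "\<lambda>_. 0" and h = "\<lambda>n. U x0 - \<phi> x0 + e n - m n"])
    show "(\<lambda>n. U x0 - \<phi> x0 + e n - m n) \<longlonglongrightarrow> 0"
      using tendsto_diff[OF tendsto_add[OF tendsto_const e] mlim, of "U x0 - \<phi> x0"] by simp
  qed (use up in \<open>auto intro!: always_eventually simp: algebra_simps\<close>)
  from tendsto_real_sqrt[OF this] have "(\<lambda>n. norm (z n - x0)) \<longlonglongrightarrow> 0" by simp
  then have zlim: "z \<longlonglongrightarrow> x0" by (simp add: tendsto_norm_zero_iff LIM_zero_iff)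
  have \<psi>z: "(\<lambda>n. \<psi> (z n)) \<longlonglongrightarrow> \<phi> x0"
    using continuous_on_tendsto_compose[OF cont(1) zlim] \<psi>0 by simp
  have "(\<lambda>n. m n + \<psi> (z n)) \<longlonglongrightarrow> U x0"
    using tendsto_add[OF mlim \<psi>z] by simp
  then have uz: "(\<lambda>n. u n (z n)) \<longlonglongrightarrow> U x0" by (simp add: m_def)
  have "continuous_on UNIV D\<psi>" using \<psi> unfolding test_function_def by blast
  from continuous_on_tendsto_compose[OF this zlim]
  have "(\<lambda>n. D\<psi> (z n)) \<longlonglongrightarrow> D\<psi> x0" by simp
  then have Dz: "(\<lambda>n. D\<psi> (z n)) \<longlonglongrightarrow> D\<phi> x0" by (simp add: D\<psi>_def)
  have "\<forall>\<^sub>F n in sequentially. z n \<in> ball x0 r"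
    using zlim r by (metis centre_in_ball open_ball topological_tendstoD)
  then have "\<forall>\<^sub>F n in sequentially. \<forall>\<^sub>F y in nhds (z n). u n y - \<psi> y \<le> u n (z n) - \<psi> (z n)"
  proof eventually_elim
    case (elim n)
    then have "\<forall>\<^sub>F y in nhds (z n). y \<in> ball x0 r" by (intro eventually_nhds_in_open) auto
    then show ?case by eventually_elim (auto intro!: z(2))
  qed
  then show thesis using that \<psi> zlim uz Dz by blast
qed

text \<open>
  The approximating sequence may depend on the point \<open>x\<close>. This covers a supremum of subsolutions,
  whose upper envelope is approached along a different sequence at each point, as well as a
  uniform limit of solutions of varying equations.
\<close>

lemma subsolution_relaxed_limit:
  fixes U :: "'a::euclidean_space \<Rightarrow> real"
  assumes "\<And>x. \<exists>F u e y. (\<forall>n. usc (u n) \<and> viscosity_subsolution (F n) (u n) \<and>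
        (\<forall>y. u n y \<le> U y + e n)) \<and> e \<longlonglongrightarrow> 0 \<and> y \<longlonglongrightarrow> x \<and> (\<lambda>n. u n (y n)) \<longlonglongrightarrow> U x \<and>
      (\<forall>z r p q. z \<longlonglongrightarrow> x \<longrightarrow> r \<longlonglongrightarrow> U x \<longrightarrow> p \<longlonglongrightarrow> q \<longrightarrow>
        (\<forall>\<^sub>F n in sequentially. F n (z n) (r n) (p n) \<le> 0) \<longrightarrow> G x (U x) q \<le> (0::real))"
  shows "viscosity_subsolution G U"
proof (rule subsolutionI)
  fix \<phi> D\<phi> x
  assume \<phi>: "test_function \<phi> D\<phi>" "\<forall>\<^sub>F y in nhds x. U y - \<phi> y \<le> U x - \<phi> x"
  obtain F u e y where u: "\<And>n. usc (u n)" "\<And>n. viscosity_subsolution (F n) (u n)"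
      "\<And>n y. u n y \<le> U y + e n" "e \<longlonglongrightarrow> 0" "y \<longlonglongrightarrow> x" "(\<lambda>n. u n (y n)) \<longlonglongrightarrow> U x"
    and G: "\<And>z r p q. z \<longlonglongrightarrow> x \<Longrightarrow> r \<longlonglongrightarrow> U x \<Longrightarrow> p \<longlonglongrightarrow> q \<Longrightarrow>
        \<forall>\<^sub>F n in sequentially. F n (z n) (r n) (p n) \<le> 0 \<Longrightarrow> G x (U x) q \<le> 0"
    using assms[of x] by (elim exE) blast
  obtain z \<psi> D\<psi> where z: "test_function \<psi> D\<psi>" "z \<longlonglongrightarrow> x" "(\<lambda>n. u n (z n)) \<longlonglongrightarrow> U x"
    "(\<lambda>n. D\<psi> (z n)) \<longlonglongrightarrow> D\<phi> x"
    and max: "\<forall>\<^sub>F n in sequentially. \<forall>\<^sub>F y in nhds (z n). u n y - \<psi> y \<le> u n (z n) - \<psi> (z n)"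
    using relaxed_limit_contact_points[OF \<phi> u(1) u(3-6)] .
  from max have "\<forall>\<^sub>F n in sequentially. F n (z n) (u n (z n)) (D\<psi> (z n)) \<le> 0"
    by eventually_elim (rule subsolutionD[OF u(2) z(1)])
  from G[OF z(2-4) this] show "G x (U x) (D\<phi> x) \<le> 0" .
qed

section \<open>Comparison of periodic solutions\<close>

lemma int_periodicD:
  assumes "int_periodic f" "\<And>i. k $ i \<in> \<int>"
  shows "f (x + k) = f x"
  using assms unfolding int_periodic_def by blast

lemma unit_cube_representative:
  fixes x :: "real ^ 'n"
  obtains k where "\<And>i. k $ i \<in> \<int>" "x + k \<in> cbox 0 1"
proof
  show "(\<chi> i. - of_int \<lfloor>x $ i\<rfloor> :: real ^ 'n) $ i \<in> \<int>" for i by simp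
  have "0 \<le> x $ i - of_int \<lfloor>x $ i\<rfloor> \<and> x $ i - of_int \<lfloor>x $ i\<rfloor> \<le> 1" for i
    using floor_correct[of "x $ i"] by linarith
  then show "x + (\<chi> i. - of_int \<lfloor>x $ i\<rfloor>) \<in> cbox 0 1"
    by (simp add: mem_box_cart)
qed

lemma periodic_usc_attains_max:
  fixes u :: "real ^ 'n \<Rightarrow> real"
  assumes "int_periodic u" "usc u"
  obtains x where "\<And>y. u y \<le> u x"
proof -
  have "(0 :: real ^ 'n) \<in> cbox 0 1" by (simp add: mem_box_cart)
  then have "cbox 0 (1 :: real ^ 'n) \<noteq> {}" by blast
  then obtain x where x: "\<And>y. y \<in> cbox 0 1 \<Longrightarrow> u y \<le> u x"
    using usc_attains_max[OF assms(2) compact_cbox] by blast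
  have "u y \<le> u x" for y
  proof -
    obtain k where "\<And>i. k $ i \<in> \<int>" "y + k \<in> cbox 0 1" using unit_cube_representative[of y] by blast
    then show ?thesis using x int_periodicD[OF assms(1)] by metis
  qed
  then show thesis by (rule that)
qed

lemma periodic_continuous_bounded:
  fixes g :: "real ^ 'n \<Rightarrow> real"
  assumes "int_periodic g" "continuous_on UNIV g"
  obtains C where "C \<ge> 0" "\<And>y. \<bar>g y\<bar> \<le> C"
proof -
  have "int_periodic (\<lambda>x. \<bar>g x\<bar>)" using assms(1) unfolding int_periodic_def by simp
  moreover have "usc (\<lambda>x. \<bar>g x\<bar>)"
    by (rule continuous_imp_usc) (intro continuous_intros assms(2))
  ultimately obtain x where "\<And>y. \<bar>g y\<bar> \<le> \<bar>g x\<bar>" using periodic_usc_attains_max by blast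
  then show thesis by (intro that[of "\<bar>g x\<bar>"]) auto
qed

lemma modulus_of_continuity_tendsto:
  assumes "modulus_of_continuity \<omega>" "\<And>n. s n \<ge> 0" "s \<longlonglongrightarrow> 0"
  shows "(\<lambda>n. \<omega> (s n)) \<longlonglongrightarrow> 0"
proof (rule tendstoI)
  fix e :: real assume "e > 0"
  have "(\<omega> \<longlongrightarrow> 0) (at_right 0)" "\<omega> 0 = 0"
    using assms(1) unfolding modulus_of_continuity_def by auto
  then have "\<forall>\<^sub>F r in at_right 0. dist (\<omega> r) 0 < e" using \<open>e > 0\<close> by (metis tendstoD)
  then obtain b where "b > 0" and b: "\<And>r. 0 < r \<Longrightarrow> r < b \<Longrightarrow> dist (\<omega> r) 0 < e"
    unfolding eventually_at_right_field by auto
  have "\<forall>\<^sub>F n in sequentially. s n < b"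
    using order_tendstoD(2)[OF assms(3) \<open>b > 0\<close>] .
  then show "\<forall>\<^sub>F n in sequentially. dist (\<omega> (s n)) 0 < e"
  proof eventually_elim
    case (elim n)
    show ?case
      using b[of "s n"] elim assms(2)[of n] \<open>\<omega> 0 = 0\<close> \<open>e > 0\<close> by (cases "s n = 0") auto
  qed
qed

lemma hamiltonian_continuous: "hamiltonian H \<Longrightarrow> continuous_on UNIV (\<lambda>(x, p). H x p)"
  unfolding hamiltonian_def by blast

text \<open>
  The doubled function is invariant only under common integer translations of both arguments, so
  its maxima are sought with the first argument in the unit cube and the second in a
  ball. The maximum value bounds the penalty, which forces both arguments to the same limit.
\<close>

lemma doubled_maximum:
  fixes u w :: "real ^ 'n \<Rightarrow> real"
  assumes u: "int_periodic u" "usc u" and w: "int_periodic w" "usc (\<lambda>x. - w x)"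
  obtains x y x0 r where "strict_mono r" "x \<longlonglongrightarrow> x0" "y \<longlonglongrightarrow> x0"
    "\<And>n a b. u a - w b - real (Suc (r n)) / 2 * (norm (a - b))\<^sup>2
        \<le> u (x n) - w (y n) - real (Suc (r n)) / 2 * (norm (x n - y n))\<^sup>2"
proof -
  obtain A where A: "\<And>x. u x \<le> A" using periodic_usc_attains_max[OF u] by metis
  have "int_periodic (\<lambda>x. - w x)" using w(1) unfolding int_periodic_def by simp
  then obtain B where B: "\<And>x. B \<le> w x"
    using periodic_usc_attains_max[OF _ w(2)] by (metis neg_le_iff_le)
  define c where "c = A - B - (u 0 - w 0)"
  have "c \<ge> 0" using A[of 0] B[of 0] unfolding c_def by simp
  have "bounded (cbox 0 (1 :: real ^ 'n))" by (rule bounded_cbox)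
  then obtain R0 where R0: "\<And>x. x \<in> cbox 0 (1 :: real ^ 'n) \<Longrightarrow> norm x \<le> R0"
    unfolding bounded_iff by blast
  define K where "K = cbox 0 (1 :: real ^ 'n) \<times> cball (0 :: real ^ 'n) (R0 + 2 * (c + 1))"
  define \<Phi> where "\<Phi> n z = u (fst z) - w (snd z) - real (Suc n) / 2 * (norm (fst z - snd z))\<^sup>2"
    for n and z :: "(real ^ 'n) \<times> (real ^ 'n)"
  have zeroc: "(0 :: real ^ 'n) \<in> cbox 0 1" by (simp add: mem_box_cart)
  with R0 \<open>c \<ge> 0\<close> have zero: "(0, 0) \<in> K" unfolding K_def by fastforce
  have "compact K" unfolding K_def by (intro compact_Times compact_cbox compact_cball)
  have usc: "usc (\<Phi> n)" for n
  proof -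
    have "usc (\<lambda>z. u (fst z) + - w (snd z))"
      by (rule usc_add[OF usc_compose[OF u(2)] usc_compose[OF w(2)]])
        (auto intro!: continuous_intros)
    moreover have "usc (\<lambda>z :: (real ^ 'n) \<times> (real ^ 'n). - (real (Suc n) / 2 * (norm (fst z - snd z))\<^sup>2))"
      by (rule continuous_imp_usc) (intro continuous_intros)
    ultimately show ?thesis
      using usc_add unfolding \<Phi>_def by fastforce
  qed
  have "\<exists>z\<in>K. \<forall>a b. \<Phi> n (a, b) \<le> \<Phi> n z" for n
  proof -
    obtain z where z: "z \<in> K" "\<And>z'. z' \<in> K \<Longrightarrow> \<Phi> n z' \<le> \<Phi> n z"
      using usc_attains_max[OF usc \<open>compact K\<close>] zero by blast
    have "\<Phi> n (a, b) \<le> \<Phi> n z" for a b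
    proof -
      \<comment> \<open>A common integer translation does not change the value; then the penalty rules out far
        away second arguments.\<close>
      obtain k where k: "\<And>i. k $ i \<in> \<int>" "a + k \<in> cbox 0 1"
        using unit_cube_representative[of a] by blast
      have eq: "\<Phi> n (a, b) = \<Phi> n (a + k, b + k)"
        unfolding \<Phi>_def using int_periodicD[OF u(1) k(1)] int_periodicD[OF w(1) k(1)] by simp
      show ?thesis
      proof (cases "(a + k, b + k) \<in> K")
        case True
        then show ?thesis using z(2) eq by simp
      next
        case False
        then have "norm (b + k) > R0 + 2 * (c + 1)" using k(2) unfolding K_def by auto
        moreover have "norm (b + k) \<le> norm (a + k) + norm (a - b)"
          using norm_triangle_ineq4[of "a + k" "a - b"] by (simp add: add.commute)
        ultimately have "norm (a - b) \<ge> 2 * (c + 1)" using R0[OF k(2)] by linarith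
        then have "(norm (a - b))\<^sup>2 \<ge> (2 * (c + 1))\<^sup>2" using \<open>c \<ge> 0\<close> by (intro power_mono) auto
        moreover have "(2 * (c + 1))\<^sup>2 \<ge> 2 * c" using \<open>c \<ge> 0\<close>
          by (simp add: power2_eq_square algebra_simps)
        ultimately have "(norm (a - b))\<^sup>2 / 2 \<ge> c" by simp
        moreover have "real (Suc n) / 2 * (norm (a - b))\<^sup>2 \<ge> (norm (a - b))\<^sup>2 / 2"
          by (simp add: field_simps)
        ultimately have "\<Phi> n (a, b) \<le> \<Phi> n (0, 0)"
          unfolding \<Phi>_def using A[of a] B[of b] by (simp add: c_def)
        then show ?thesis using z(2)[OF zero] by linarith
      qed
    qed
    then show ?thesis using z(1) by blast
  qed
  then obtain z where z: "\<And>n. z n \<in> K" "\<And>n a b. \<Phi> n (a, b) \<le> \<Phi> n (z n)" by metis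
  obtain l r where l: "strict_mono (r :: nat \<Rightarrow> nat)" "(z \<circ> r) \<longlonglongrightarrow> l"
    using \<open>compact K\<close> z(1) unfolding compact_def by metis
  define x y where "x n = fst (z (r n))" and "y n = snd (z (r n))" for n
  have lim: "x \<longlonglongrightarrow> fst l" "y \<longlonglongrightarrow> snd l"
    using tendsto_fst[OF l(2)] tendsto_snd[OF l(2)] unfolding x_def y_def by (simp_all add: o_def)
  have max: "u a - w b - real (Suc (r n)) / 2 * (norm (a - b))\<^sup>2
        \<le> u (x n) - w (y n) - real (Suc (r n)) / 2 * (norm (x n - y n))\<^sup>2" for n a b
    using z(2)[of "r n" a b] unfolding \<Phi>_def x_def y_def by simp
  have bound: "(norm (x n - y n))\<^sup>2 \<le> 2 * c * inverse (real (Suc n))" for n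
  proof -
    have "real (Suc (r n)) / 2 * (norm (x n - y n))\<^sup>2 \<le> c"
      using max[where a = 0 and b = 0, of n] A[of "x n"] B[of "y n"] by (simp add: c_def)
    moreover have "real (Suc n) / 2 * (norm (x n - y n))\<^sup>2 \<le> real (Suc (r n)) / 2 * (norm (x n - y n))\<^sup>2"
      using seq_suble[OF l(1), of n] by (intro mult_right_mono) auto
    ultimately show ?thesis by (simp add: field_simps)
  qed
  have "(\<lambda>n. (norm (x n - y n))\<^sup>2) \<longlonglongrightarrow> 0"
  proof (rule tendsto_sandwich[where f = "\<lambda>_. 0"])
    show "(\<lambda>n. 2 * c * inverse (real (Suc n))) \<longlonglongrightarrow> 0"
      using tendsto_mult[OF tendsto_const LIMSEQ_inverse_real_of_nat, of "2 * c"] by simp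
  qed (use bound in \<open>auto intro!: always_eventually\<close>)
  moreover have "(\<lambda>n. (norm (x n - y n))\<^sup>2) \<longlonglongrightarrow> (norm (fst l - snd l))\<^sup>2"
    by (intro tendsto_intros lim)
  ultimately have "(norm (fst l - snd l))\<^sup>2 = 0" using LIMSEQ_unique by blast
  then have "snd l = fst l" by simp
  with lim show thesis by (intro that[OF l(1) _ _ max]) simp_all
qed

text \<open>
  Doubling of variables, in a form from which every comparison below can be read off: at some
  maximum of \<open>u - w\<close> the two equations may be compared as if \<open>u\<close> and \<open>w\<close> had equal gradients
  there. At the maxima of the doubled function both equations hold with the common gradient
  \<open>p = (n + 1)(x - y)\<close>, and \<open>|x - y| |p|\<close> tends to zero, which is what the continuity of \<open>H\<close> in \<open>x\<close>
  requires.
\<close>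

lemma comparison_at_max:
  fixes u w :: "real ^ 'n \<Rightarrow> real"
  assumes H: "hamiltonian H"
    and a: "continuous_on UNIV (\<lambda>(x, r). a x r)" and b: "continuous_on UNIV (\<lambda>(x, r). b x r)"
    and u: "int_periodic u" "usc u" "viscosity_subsolution (\<lambda>x r p. a x r + H x p) u"
    and w: "int_periodic w" "usc (\<lambda>x. - w x)" "viscosity_supersolution (\<lambda>x r p. b x r + H x p) w"
  obtains x where "\<And>y. u y - w y \<le> u x - w x" "a x (u x) \<le> b x (w x)"
proof -
  obtain x y x0 r where r: "strict_mono r" and x: "x \<longlonglongrightarrow> x0" and y: "y \<longlonglongrightarrow> x0"
    and max: "\<And>n c d. u c - w d - real (Suc (r n)) / 2 * (norm (c - d))\<^sup>2
        \<le> u (x n) - w (y n) - real (Suc (r n)) / 2 * (norm (x n - y n))\<^sup>2"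
    by (rule doubled_maximum[OF u(1,2) w(1,2)]) blast
  have pen: "0 \<le> real (Suc (r n)) / 2 * (norm (x n - y n))\<^sup>2" for n by simp
  have above: "u c - w c \<le> u (x n) - w (y n)" for n c
  proof -
    have "u c - w c \<le> u (x n) - w (y n) - real (Suc (r n)) / 2 * (norm (x n - y n))\<^sup>2"
      using max[where c = c and d = c, of n] by simp
    then show ?thesis using pen[of n] by linarith
  qed
  have ulim: "(\<lambda>n. u (x n)) \<longlonglongrightarrow> u x0" and wlim: "(\<lambda>n. w (y n)) \<longlonglongrightarrow> w x0"
  proof -
    have "(\<forall>\<^sub>F n in sequentially. dist (u (x n)) (u x0) < e) \<and>
      (\<forall>\<^sub>F n in sequentially. dist (w (y n)) (w x0) < e)" if "e > 0" for e
    proof -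
      have "\<forall>\<^sub>F n in sequentially. u (x n) < u x0 + e"
        using usc_eventually_less_sequentially[OF u(2) x] that by simp
      moreover have "\<forall>\<^sub>F n in sequentially. - w (y n) < - w x0 + e"
        using usc_eventually_less_sequentially[OF w(2) y] that by simp
      ultimately have "\<forall>\<^sub>F n in sequentially. dist (u (x n)) (u x0) < e \<and> dist (w (y n)) (w x0) < e"
      proof eventually_elim
        case (elim n)
        then show ?case using above[of x0 n] unfolding dist_real_def by linarith
      qed
      then show ?thesis unfolding eventually_conj_iff .
    qed
    then show "(\<lambda>n. u (x n)) \<longlonglongrightarrow> u x0" "(\<lambda>n. w (y n)) \<longlonglongrightarrow> w x0"
      by (auto intro!: tendstoI)
  qed
  have diff: "(\<lambda>n. u (x n) - w (y n)) \<longlonglongrightarrow> u x0 - w x0"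
    by (intro tendsto_intros ulim wlim)
  have x0_max: "u c - w c \<le> u x0 - w x0" for c
    by (rule LIMSEQ_le_const[OF diff]) (use above in blast)
  define p where "p n = real (Suc (r n)) *\<^sub>R (x n - y n)" for n
  define s where "s n = norm (y n - x n) * (1 + norm (p n))" for n
  have "(\<lambda>n. real (Suc (r n)) / 2 * (norm (x n - y n))\<^sup>2) \<longlonglongrightarrow> 0"
  proof (rule tendsto_sandwich[where f = "\<lambda>_. 0"])
    show "\<forall>\<^sub>F n in sequentially. real (Suc (r n)) / 2 * (norm (x n - y n))\<^sup>2
        \<le> (u (x n) - w (y n)) - (u x0 - w x0)"
      using max[where c = x0 and d = x0] by (auto intro!: always_eventually simp: algebra_simps)
    show "(\<lambda>n. (u (x n) - w (y n)) - (u x0 - w x0)) \<longlonglongrightarrow> 0"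
      using tendsto_diff[OF diff tendsto_const, of "u x0 - w x0"] by simp
  qed (use pen in auto)
  from tendsto_mult[OF tendsto_const this, of 2]
  have pen0: "(\<lambda>n. real (Suc (r n)) * (norm (x n - y n))\<^sup>2) \<longlonglongrightarrow> 0" by (simp add: mult.assoc)
  have "s = (\<lambda>n. norm (x n - y n) + real (Suc (r n)) * (norm (x n - y n))\<^sup>2)"
  proof
    fix n
    have "norm (p n) = real (Suc (r n)) * norm (x n - y n)" unfolding p_def by simp
    then show "s n = norm (x n - y n) + real (Suc (r n)) * (norm (x n - y n))\<^sup>2"
      unfolding s_def norm_minus_commute[of "y n"] by (simp add: power2_eq_square algebra_simps)
  qed
  moreover have "(\<lambda>n. norm (x n - y n)) \<longlonglongrightarrow> norm (x0 - x0)" by (intro tendsto_intros x y)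
  ultimately have s0: "s \<longlonglongrightarrow> 0" using tendsto_add[OF _ pen0] by fastforce
  have s_nonneg: "s n \<ge> 0" for n unfolding s_def by simp
  obtain \<omega> where \<omega>: "modulus_of_continuity \<omega>"
    "\<And>x y p. \<bar>H x p - H y p\<bar> \<le> \<omega> (norm (x - y) * (1 + norm p))"
    using H unfolding hamiltonian_def by blast
  have sub: "a (x n) (u (x n)) + H (x n) (p n) \<le> 0" for n
  proof -
    have *: "test_function (\<lambda>c. real (Suc (r n)) / 2 * (norm (c - y n))\<^sup>2)
        (\<lambda>c. real (Suc (r n)) *\<^sub>R (c - y n))"
      by (rule test_function_quadratic)
    have "\<forall>\<^sub>F c in nhds (x n). u c - real (Suc (r n)) / 2 * (norm (c - y n))\<^sup>2
        \<le> u (x n) - real (Suc (r n)) / 2 * (norm (x n - y n))\<^sup>2"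
    proof (intro always_eventually allI)
      fix c show "u c - real (Suc (r n)) / 2 * (norm (c - y n))\<^sup>2
        \<le> u (x n) - real (Suc (r n)) / 2 * (norm (x n - y n))\<^sup>2"
        using max[where c = c and d = "y n", of n] by linarith
    qed
    from subsolutionD[OF u(3) * this] show ?thesis by (simp add: p_def del: of_nat_Suc)
  qed
  have sup: "b (y n) (w (y n)) + H (y n) (p n) \<ge> 0" for n
  proof -
    have *: "test_function (\<lambda>c. - real (Suc (r n)) / 2 * (norm (c - x n))\<^sup>2)
        (\<lambda>c. (- real (Suc (r n))) *\<^sub>R (c - x n))"
      by (rule test_function_quadratic)
    have "\<forall>\<^sub>F c in nhds (y n). w c - - real (Suc (r n)) / 2 * (norm (c - x n))\<^sup>2
        \<ge> w (y n) - - real (Suc (r n)) / 2 * (norm (y n - x n))\<^sup>2"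
    proof (intro always_eventually allI)
      fix c show "w c - - real (Suc (r n)) / 2 * (norm (c - x n))\<^sup>2
        \<ge> w (y n) - - real (Suc (r n)) / 2 * (norm (y n - x n))\<^sup>2"
        using max[where c = "x n" and d = c, of n]
        by (simp add: norm_minus_commute[of c] norm_minus_commute[of "y n"] del: of_nat_Suc)
    qed
    from supersolutionD[OF w(3) * this] show ?thesis
      by (simp add: p_def scaleR_diff_right del: of_nat_Suc)
  qed
  have "a (x n) (u (x n)) - b (y n) (w (y n)) \<le> \<omega> (s n)" for n
    using sub[of n] sup[of n] \<omega>(2)[of "y n" "p n" "x n"] unfolding s_def by linarith
  moreover have "(\<lambda>n. a (x n) (u (x n))) \<longlonglongrightarrow> a x0 (u x0)"
    using continuous_on_tendsto_compose[OF a tendsto_Pair[OF x ulim]] by simp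
  moreover have "(\<lambda>n. b (y n) (w (y n))) \<longlonglongrightarrow> b x0 (w x0)"
    using continuous_on_tendsto_compose[OF b tendsto_Pair[OF y wlim]] by simp
  ultimately have "a x0 (u x0) - b x0 (w x0) \<le> 0"
    by (intro LIMSEQ_le[OF tendsto_diff modulus_of_continuity_tendsto[OF \<omega>(1) s_nonneg s0]]) auto
  with x0_max show thesis by (intro that) auto
qed

section \<open>Perron's method\<close>

text \<open>
  A subsolution may be raised to a classical subsolution \<open>\<psi>\<close> on a closed set \<open>K\<close>, provided that
  this changes nothing in a neighbourhood \<open>B - K\<close> of the boundary: at a point where the
  new function exceeds \<open>u\<close> it equals \<open>\<psi>\<close>, and a test function from above then has the
  gradient of \<open>\<psi>\<close>.
\<close>

lemma subsolution_glue:
  fixes u :: "'a::euclidean_space \<Rightarrow> real"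
  assumes u: "usc u" "viscosity_subsolution F u" and \<psi>: "test_function \<psi> D\<psi>"
    and K: "closed K" "open B" "K \<subseteq> B"
    and sub: "\<And>y. y \<in> B \<Longrightarrow> F y (\<psi> y) (D\<psi> y) \<le> 0"
    and above: "\<And>y. y \<in> B - K \<Longrightarrow> \<psi> y \<le> u y"
  defines "v \<equiv> \<lambda>y. if y \<in> K then max (u y) (\<psi> y) else u y"
  shows "usc v" "viscosity_subsolution F v"
proof -
  have v_ge: "u y \<le> v y" for y unfolding v_def by simp
  have v_ge': "\<psi> y \<le> v y" if "y \<in> B" for y
    using above[of y] that unfolding v_def by (cases "y \<in> K") auto
  have "{y. v y < c} = {y. u y < c} \<inter> ({y. \<psi> y < c} \<union> - K)" for c
    unfolding v_def by auto
  moreover have "usc \<psi>" using continuous_imp_usc test_function_continuous[OF \<psi>] by blast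
  ultimately show "usc v" using u(1) K(1) unfolding usc_def
    by (auto intro!: open_Int open_Un open_Compl)
  show "viscosity_subsolution F v"
  proof (rule subsolutionI)
    fix \<phi> D\<phi> x
    assume \<phi>: "test_function \<phi> D\<phi>" and max: "\<forall>\<^sub>F y in nhds x. v y - \<phi> y \<le> v x - \<phi> x"
    show "F x (v x) (D\<phi> x) \<le> 0"
    proof (cases "v x = u x")
      case True
      from max have "\<forall>\<^sub>F y in nhds x. u y - \<phi> y \<le> u x - \<phi> x"
      proof eventually_elim
        case (elim y)
        then show ?case using v_ge[of y] True by simp
      qed
      then show ?thesis using subsolutionD[OF u(2) \<phi>] True by simp
    next
      case False
      then have "x \<in> K" and eq: "v x = \<psi> x" unfolding v_def by (auto split: if_splits)
      then have "x \<in> B" using K by blast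
      then have "\<forall>\<^sub>F y in nhds x. y \<in> B" using K(2) by (simp add: eventually_nhds_in_open)
      with max have "\<forall>\<^sub>F y in nhds x. \<psi> y + - \<phi> y \<le> \<psi> x + - \<phi> x"
      proof eventually_elim
        case (elim y)
        then show ?case using v_ge'[of y] eq by simp
      qed
      from gradient_eq_0_at_local_max[OF test_function_add[OF \<psi> test_function_minus[OF \<phi>]] this]
      have "D\<phi> x = D\<psi> x" by simp
      then show ?thesis using sub[OF \<open>x \<in> B\<close>] eq by simp
    qed
  qed
qed

text \<open>
  The supremum \<open>U\<close> of all upper semicontinuous subsolutions below \<open>c1\<close> is the largest of them,
  because its upper envelope is again one. Suppose that its
  lower envelope \<open>L\<close> is not a supersolution at \<open>x\<close>. The test function that touches \<open>L\<close> at \<open>x\<close> from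
  below, lowered by \<open>|y - x|\<^sup>2\<close> and raised by a small constant \<open>\<eta>\<close>, is then a classical subsolution
  near \<open>x\<close>, lies below \<open>U\<close> away from \<open>x\<close>, and exceeds \<open>U\<close> somewhere close to \<open>x\<close>; gluing it on top
  of \<open>U\<close> gives a larger subsolution. It stays below \<open>c1\<close> since \<open>L x = c1\<close> would force the gradient
  of the test function to vanish, contrary to \<open>F x c1 0 > 0\<close>.
\<close>

lemma perron_method:
  fixes F :: "'a::euclidean_space \<Rightarrow> real \<Rightarrow> 'a \<Rightarrow> real"
  assumes F: "continuous_on UNIV (\<lambda>(x, r, p). F x r p)"
    and c0: "\<And>x. F x c0 0 \<le> 0" and c1: "\<And>x. F x c1 0 > 0" and "c0 \<le> c1"
  obtains U L where "usc U" "viscosity_subsolution F U"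
    "usc (\<lambda>x. - L x)" "viscosity_supersolution F L" "\<And>x. L x \<le> U x"
    "\<And>k x. (\<And>y. F (y + k) = F y) \<Longrightarrow> U (x + k) = U x"
    "\<And>k x. (\<And>y. F (y + k) = F y) \<Longrightarrow> L (x + k) = L x"
proof -
  define S where "S = {v. usc v \<and> viscosity_subsolution F v \<and> (\<forall>x. v x \<le> c1)}"
  define U where "U x = (SUP v\<in>S. v x)" for x
  have const: "(\<lambda>x. c0) \<in> S"
    unfolding S_def using c0 \<open>c0 \<le> c1\<close>
    by (auto intro: subsolution_const continuous_imp_usc)
  have bdd: "bdd_above ((\<lambda>v. v x) ` S)" for x
    by (rule bdd_aboveI[of _ c1]) (auto simp: S_def)
  have U_upper: "v x \<le> U x" if "v \<in> S" for v x
    unfolding U_def using that bdd by (rule cSUP_upper)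
  have U_le: "U x \<le> c1" for x
    unfolding U_def using const by (intro cSUP_least) (auto simp: S_def)
  have U_ge: "c0 \<le> U x" for x using U_upper[OF const] .
  define E where "E = usc_envelope U"
  have U_E: "U x \<le> E x" for x unfolding E_def by (rule usc_envelope_ge[of U c1, OF U_le])
  have E_usc: "usc E" unfolding E_def by (rule usc_usc_envelope[of U c1, OF U_le])
  have E_le: "E x \<le> c1" for x
    unfolding E_def using U_le by (intro usc_envelope_least continuous_imp_usc) auto
  have E_sub: "viscosity_subsolution F E"
  proof (rule subsolution_relaxed_limit[of E F])
    fix x
    have "\<exists>v y. v \<in> S \<and> dist y x < inverse (Suc n) \<and> E x - inverse (Suc n) < v y" for n
    proof -
      have "\<forall>\<^sub>F y in nhds x. dist y x < inverse (Suc n)"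
        unfolding eventually_nhds_metric by (intro exI[of _ "inverse (Suc n)"]) auto
      with usc_envelope_approx[of "E x - inverse (Suc n)" U x]
      obtain y where y: "dist y x < inverse (Suc n)" "E x - inverse (Suc n) < U y"
        unfolding E_def by force
      with less_cSUP_iff[OF _ bdd[of y], of "E x - inverse (Suc n)"] const
      show ?thesis unfolding U_def by fast
    qed
    then obtain v y where v: "\<And>n. v n \<in> S" "\<And>n. dist (y n) x < inverse (Suc n)"
      "\<And>n. E x - inverse (Suc n) < v n (y n)" by metis
    have v_le: "v n z \<le> E z" for n z using U_upper[OF v(1)] U_E order_trans by blast
    have y: "y \<longlonglongrightarrow> x"
      by (rule metric_tendsto_imp_tendsto[OF LIMSEQ_inverse_real_of_nat])
        (use v(2) in \<open>auto intro!: always_eventually less_imp_le\<close>)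
    have vy: "(\<lambda>n. v n (y n)) \<longlonglongrightarrow> E x"
    proof (rule order_tendstoI)
      fix c assume "c < E x"
      have "(\<lambda>n. E x - inverse (Suc n)) \<longlonglongrightarrow> E x - 0"
        by (intro tendsto_diff tendsto_const LIMSEQ_inverse_real_of_nat)
      then have "\<forall>\<^sub>F n in sequentially. c < E x - inverse (Suc n)"
        using \<open>c < E x\<close> by (intro order_tendstoD(1)) auto
      then show "\<forall>\<^sub>F n in sequentially. c < v n (y n)"
        by eventually_elim (use v(3) in \<open>auto intro: less_trans\<close>)
    next
      fix c assume "E x < c"
      from usc_eventually_less_sequentially[OF E_usc y this]
      show "\<forall>\<^sub>F n in sequentially. v n (y n) < c"
        by eventually_elim (rule le_less_trans[OF v_le])
    qed
    have lim: "F x (E x) q \<le> 0"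
      if "z \<longlonglongrightarrow> x" "r \<longlonglongrightarrow> E x" "p \<longlonglongrightarrow> q" "\<forall>\<^sub>F n in sequentially. F (z n) (r n) (p n) \<le> 0"
      for z r p q
    proof -
      have "(\<lambda>n. F (z n) (r n) (p n)) \<longlonglongrightarrow> F x (E x) q"
        using continuous_on_tendsto_compose[OF F tendsto_Pair[OF that(1) tendsto_Pair[OF that(2,3)]]]
        by simp
      from tendsto_upperbound[OF this that(4)] show ?thesis by simp
    qed
    have "usc (v n) \<and> viscosity_subsolution F (v n) \<and> (\<forall>y. v n y \<le> E y + 0)" for n
      using v(1)[of n] v_le[of n] unfolding S_def by simp
    then show "\<exists>G u e y. (\<forall>n. usc (u n) \<and> viscosity_subsolution (G n) (u n) \<and>
        (\<forall>y. u n y \<le> E y + e n)) \<and> e \<longlonglongrightarrow> 0 \<and> y \<longlonglongrightarrow> x \<and> (\<lambda>n. u n (y n)) \<longlonglongrightarrow> E x \<and>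
      (\<forall>z r p q. z \<longlonglongrightarrow> x \<longrightarrow> r \<longlonglongrightarrow> E x \<longrightarrow> p \<longlonglongrightarrow> q \<longrightarrow>
        (\<forall>\<^sub>F n in sequentially. G n (z n) (r n) (p n) \<le> 0) \<longrightarrow> F x (E x) q \<le> 0)"
      using y vy lim by - (rule exI[of _ "\<lambda>_. F"], rule exI[of _ v], rule exI[of _ "\<lambda>_. 0"],
          rule exI[of _ y], intro conjI, simp, simp, blast+)
  qed
  have "E \<in> S" unfolding S_def using E_usc E_sub E_le by blast
  then have "U = E" using U_upper U_E by (intro ext antisym) auto
  then have U_usc: "usc U" and U_sub: "viscosity_subsolution F U" and "U \<in> S"
    using E_usc E_sub \<open>E \<in> S\<close> by auto
  define L where "L x = - usc_envelope (\<lambda>y. - U y) x" for x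
  have neg_le: "- U x \<le> - c0" for x using U_ge by simp
  have L_usc: "usc (\<lambda>x. - L x)"
    unfolding L_def using usc_usc_envelope[of "\<lambda>y. - U y", OF neg_le] by simp
  have L_le: "L x \<le> U x" for x
    unfolding L_def using usc_envelope_ge[of "\<lambda>y. - U y" _ x, OF neg_le] by simp
  have L_super: "viscosity_supersolution F L"
  proof (rule supersolutionI, rule ccontr)
    fix \<phi> D\<phi> x
    assume \<phi>: "test_function \<phi> D\<phi>" and min: "\<forall>\<^sub>F y in nhds x. L y - \<phi> y \<ge> L x - \<phi> x"
      and "\<not> F x (L x) (D\<phi> x) \<ge> 0"
    then have neg: "F x (L x) (D\<phi> x) < 0" by simp
    have "L x \<noteq> c1"
    proof
      assume "L x = c1"
      from min have "\<forall>\<^sub>F y in nhds x. \<phi> y \<le> \<phi> x"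
      proof eventually_elim
        case (elim y)
        then show ?case using \<open>L x = c1\<close> L_le[of y] U_le[of y] by simp
      qed
      from gradient_eq_0_at_local_max[OF \<phi> this] neg c1[of x] \<open>L x = c1\<close> show False by simp
    qed
    then have "L x < c1" using L_le[of x] U_le[of x] by simp
    \<comment> \<open>The parameter \<open>t\<close> is the amount of lifting: \<open>\<psi> 0\<close> touches \<open>L\<close> at \<open>x\<close>.\<close>
    define \<psi> where "\<psi> t y = \<phi> y + (- 1) * (norm (y - x))\<^sup>2 + (L x - \<phi> x + t)" for t y
    define D\<psi> where "D\<psi> y = D\<phi> y + (- 1) *\<^sub>R 2 *\<^sub>R (y - x) + 0" for y
    have \<psi>: "test_function (\<psi> t) D\<psi>" for t
      unfolding \<psi>_def D\<psi>_def
      by (intro test_function_add test_function_scale \<phi> test_function_norm_square test_function_const)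
    have D\<psi>_cont: "continuous_on UNIV D\<psi>" using \<psi> unfolding test_function_def by blast
    have "continuous_on UNIV (\<lambda>z. \<phi> (fst z))"
      by (rule continuous_on_compose2[OF test_function_continuous[OF \<phi>]])
        (auto intro!: continuous_intros)
    then have \<psi>_cont: "continuous_on UNIV (\<lambda>z. \<psi> (snd z) (fst z))"
      unfolding \<psi>_def by (intro continuous_intros)
    have "continuous_on UNIV (\<lambda>z. D\<psi> (fst z))"
      by (rule continuous_on_compose2[OF D\<psi>_cont]) (auto intro!: continuous_intros)
    then have "continuous_on UNIV (\<lambda>z. (fst z, \<psi> (snd z) (fst z), D\<psi> (fst z)))"
      by (intro continuous_intros \<psi>_cont)
    from continuous_on_compose2[OF F this]
    have F\<psi>_cont: "continuous_on UNIV (\<lambda>z. F (fst z) (\<psi> (snd z) (fst z)) (D\<psi> (fst z)))"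
      by simp
    define W where "W = {z. F (fst z) (\<psi> (snd z) (fst z)) (D\<psi> (fst z)) < 0} \<inter>
      {z. \<psi> (snd z) (fst z) < c1}"
    have "open W"
      unfolding W_def by (intro open_Int open_Collect_less F\<psi>_cont \<psi>_cont continuous_intros)
    moreover have "(x, 0) \<in> W"
      unfolding W_def using neg \<open>L x < c1\<close> by (simp add: \<psi>_def D\<psi>_def)
    ultimately obtain A T where A: "open A" "x \<in> A" and T: "open T" "0 \<in> T" and AT: "A \<times> T \<subseteq> W"
      unfolding open_prod_def by (metis mem_Sigma_iff)
    obtain O1 where O1: "open O1" "x \<in> O1" "\<And>y. y \<in> O1 \<Longrightarrow> L y - \<phi> y \<ge> L x - \<phi> x"
      using min unfolding eventually_nhds by blast
    obtain r where r: "r > 0" "ball x r \<subseteq> A \<inter> O1"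
      using A O1 open_contains_ball[of "A \<inter> O1"] by blast
    obtain d where d: "d > 0" "ball 0 d \<subseteq> T" using T open_contains_ball[of T] by blast
    define s where "s = r / 2"
    define \<eta> where "\<eta> = min (d / 2) (s\<^sup>2)"
    have s: "s > 0" "s < r" using r unfolding s_def by auto
    have \<eta>: "\<eta> > 0" "\<eta> \<in> T" "\<eta> \<le> s\<^sup>2"
      using d s unfolding \<eta>_def by (auto intro!: subsetD[OF d(2)])
    have inW: "(y, \<eta>) \<in> W" if "y \<in> ball x r" for y using that r \<eta> AT by blast
    have low: "\<psi> \<eta> y + (norm (y - x))\<^sup>2 \<le> U y + \<eta>" if "y \<in> ball x r" for y
      using O1(3)[of y] that r L_le[of y] unfolding \<psi>_def by force
    define V where "V = (\<lambda>y. if y \<in> cball x s then max (U y) (\<psi> \<eta> y) else U y)"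
    have glue: "\<psi> \<eta> y \<le> U y" if "y \<in> ball x r - cball x s" for y
    proof -
      have "s \<le> norm (y - x)" using that by (simp add: dist_norm norm_minus_commute)
      then have "s\<^sup>2 \<le> (norm (y - x))\<^sup>2" using s by (intro power_mono) auto
      then show ?thesis using low[of y] that \<eta> by simp
    qed
    have sub: "F y (\<psi> \<eta> y) (D\<psi> y) \<le> 0" if "y \<in> ball x r" for y
      using inW[OF that] unfolding W_def by simp
    have incl: "cball x s \<subseteq> ball x r" using s by (simp add: cball_subset_ball_iff)
    have "usc V" unfolding V_def
      by (rule subsolution_glue(1)[where F = F, OF U_usc U_sub \<psi> closed_cball open_ball incl])
        (use sub glue in blast)+
    moreover have "viscosity_subsolution F V" unfolding V_def
      by (rule subsolution_glue(2)[OF U_usc U_sub \<psi> closed_cball open_ball incl])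
        (use sub glue in blast)+
    moreover have "V y \<le> c1" for y
      using inW[of y] U_le[of y] s unfolding V_def W_def by auto
    ultimately have "V \<in> S" unfolding S_def by blast
    \<comment> \<open>Near \<open>x\<close> there are points where \<open>U\<close> is nearly \<open>L x\<close>, and \<open>\<psi> \<eta>\<close> is nearly \<open>L x + \<eta>\<close>.\<close>
    have "continuous_on UNIV (\<psi> \<eta>)" by (rule test_function_continuous[OF \<psi>])
    then have "open {y. L x + \<eta> / 2 < \<psi> \<eta> y}" by (intro open_Collect_less continuous_intros)
    moreover have "x \<in> {y. L x + \<eta> / 2 < \<psi> \<eta> y}" using \<eta> by (simp add: \<psi>_def)
    ultimately have "\<forall>\<^sub>F y in nhds x. L x + \<eta> / 2 < \<psi> \<eta> y"
      using eventually_nhds_in_open by fastforce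
    moreover have "\<forall>\<^sub>F y in nhds x. y \<in> ball x s" using s by (intro eventually_nhds_in_open) auto
    ultimately have "\<forall>\<^sub>F y in nhds x. L x + \<eta> / 2 < \<psi> \<eta> y \<and> y \<in> ball x s"
      by (rule eventually_conj)
    moreover have "- (L x + \<eta> / 2) < usc_envelope (\<lambda>y. - U y) x" using \<eta> by (simp add: L_def)
    ultimately obtain y where "L x + \<eta> / 2 < \<psi> \<eta> y \<and> y \<in> ball x s" "- (L x + \<eta> / 2) < - U y"
      using usc_envelope_approx by blast
    then have "U y < V y" unfolding V_def by auto
    then show False using U_upper[OF \<open>V \<in> S\<close>, of y] by simp
  qed
  have U_trans: "U (x + k) = U x" if "\<And>y. F (y + k) = F y" for k x
  proof -
    \<comment> \<open>The class \<open>S\<close> is invariant under any period of \<open>F\<close>.\<close>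
    have ge: "U x \<le> U (x - h)" if F: "\<And>y. F (y + h) = F y" for h x
    proof -
      have "(\<lambda>y. U (y + h)) \<in> S"
      proof -
        have "usc (\<lambda>y. U (y + h))"
          by (rule usc_compose[OF U_usc]) (intro continuous_intros)
        moreover have "viscosity_subsolution F (\<lambda>y. U (y + h))"
        proof (rule subsolutionI)
          fix \<phi> D\<phi> x
          assume \<phi>: "test_function \<phi> D\<phi>"
            and max: "\<forall>\<^sub>F y in nhds x. U (y + h) - \<phi> y \<le> U (x + h) - \<phi> x"
          have \<phi>': "test_function (\<lambda>y. \<phi> (y - h)) (\<lambda>y. D\<phi> (y - h))"
            unfolding test_function_def
          proof (intro conjI allI)
            fix y
            have "((\<lambda>y. \<phi> (y - h)) has_derivative (\<lambda>v. (\<lambda>v. v \<bullet> D\<phi> (y - h)) v)) (at y)"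
              by (rule has_derivative_compose[of "\<lambda>y. y - h" "\<lambda>v. v" y UNIV \<phi>])
                (use \<phi> in \<open>auto simp: test_function_def gderiv_def intro!: derivative_eq_intros\<close>)
            then show "GDERIV (\<lambda>y. \<phi> (y - h)) y :> D\<phi> (y - h)" unfolding gderiv_def .
          next
            have "continuous_on UNIV D\<phi>" using \<phi> unfolding test_function_def by blast
            then show "continuous_on UNIV (\<lambda>y. D\<phi> (y - h))"
              by (rule continuous_on_compose2) (auto intro!: continuous_intros)
          qed
          have "((\<lambda>y. y - h) \<longlongrightarrow> (x + h) - h) (nhds (x + h))"
            by (intro tendsto_diff filterlim_ident tendsto_const)
          then have "filterlim (\<lambda>y. y - h) (nhds x) (nhds (x + h))" by simp
          from eventually_compose_filterlim[OF max this]
          have "\<forall>\<^sub>F y in nhds (x + h). U y - \<phi> (y - h) \<le> U (x + h) - \<phi> (x + h - h)" by simp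
          from subsolutionD[OF U_sub \<phi>' this] show "F x (U (x + h)) (D\<phi> x) \<le> 0"
            using F[of x] by simp
        qed
        ultimately show ?thesis using U_le unfolding S_def by simp
      qed
      from U_upper[OF this, of "x - h"] show ?thesis by simp
    qed
    have "F (y + - k) = F y" for y using that[of "y + - k"] by simp
    from ge[of "- k", OF this, of x] ge[of k, OF that, of "x + k"] show ?thesis by simp
  qed
  have L_trans: "L (x + k) = L x" if "\<And>y. F (y + k) = F y" for k x
    unfolding L_def
    using usc_envelope_translation[of "\<lambda>y. - U y" "- c0" k x, OF neg_le] U_trans[of k, OF that]
    by simp
  show thesis using that[OF U_usc U_sub L_usc L_super L_le U_trans L_trans] by blast
qed

section \<open>The discounted problems\<close>

lemma continuous_if_usc:
  assumes "usc u" "usc (\<lambda>x. - u x)"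
  shows "continuous_on UNIV u"
  unfolding continuous_on_def
proof (intro ballI order_tendstoI)
  fix x c assume "c < u x"
  then have "\<forall>\<^sub>F y in nhds x. - u y < - c" using usc_eventually_less[OF assms(2), of x "- c"] by simp
  then show "\<forall>\<^sub>F y in at x. c < u y" by (simp add: eventually_nhds_conv_at)
next
  fix x c assume "u x < c"
  from usc_eventually_less[OF assms(1) this]
  show "\<forall>\<^sub>F y in at x. u y < c" by (simp add: eventually_nhds_conv_at)
qed

lemma periodic_bound_zero_gradient:
  fixes H :: "real ^ 'n \<Rightarrow> real ^ 'n \<Rightarrow> real"
  assumes "hamiltonian H" "continuous_on UNIV g" "int_periodic g"
  obtains C where "C \<ge> 0" "\<And>x. \<bar>g x + H x 0\<bar> \<le> C"
proof -
  have "int_periodic (\<lambda>x. g x + H x 0)"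
    using assms unfolding hamiltonian_def int_periodic_def by simp
  moreover have "continuous_on UNIV (\<lambda>x. H x 0)"
    using continuous_on_compose2[OF hamiltonian_continuous[OF assms(1)], of UNIV "\<lambda>x. (x, 0)"]
    by (simp add: continuous_on_Pair continuous_on_id continuous_on_const)
  then have "continuous_on UNIV (\<lambda>x. g x + H x 0)"
    by (intro continuous_intros assms(2))
  ultimately show thesis using periodic_continuous_bounded that by blast
qed

lemma discounted_solutionD:
  assumes "discounted_solution (\<lambda>x p. g x + H x p) \<delta> u"
  shows "continuous_on UNIV u" "int_periodic u"
    "viscosity_subsolution (\<lambda>x r p. (\<delta> * r + g x) + H x p) u"
    "viscosity_supersolution (\<lambda>x r p. (\<delta> * r + g x) + H x p) u"
  using assms unfolding discounted_solution_def continuous_viscosity_solution_def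
  by (simp_all add: add.assoc)

lemma usc_uminus_continuous: "continuous_on UNIV u \<Longrightarrow> usc (\<lambda>x. - u x)"
  by (intro continuous_imp_usc continuous_on_minus)

lemma discount_continuous:
  fixes g :: "'a::topological_space \<Rightarrow> real"
  assumes "continuous_on UNIV g"
  shows "continuous_on UNIV (\<lambda>(x, r). \<delta> * r + g x)"
proof -
  have "continuous_on UNIV (\<lambda>z :: 'a \<times> real. g (fst z))"
    by (rule continuous_on_compose2[OF assms]) (auto intro!: continuous_intros)
  note [continuous_intros] = this
  show ?thesis unfolding case_prod_beta by (intro continuous_intros)
qed

text \<open>
  Large positive constants are strict supersolutions and large negative ones are subsolutions, so
  Perron's method applies.
  Comparison of \<open>U\<close> with its lower envelope \<open>L\<close> then gives \<open>U = L\<close>, hence continuity.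
\<close>

lemma discounted_solution_exists:
  fixes H :: "real ^ 'n \<Rightarrow> real ^ 'n \<Rightarrow> real"
  assumes H: "hamiltonian H" and g: "continuous_on UNIV g" "int_periodic g" and "\<delta> > 0"
  shows "\<exists>u. discounted_solution (\<lambda>x p. g x + H x p) \<delta> u"
proof -
  obtain C where C: "C \<ge> 0" "\<And>x. \<bar>g x + H x 0\<bar> \<le> C"
    using periodic_bound_zero_gradient[OF H g] by blast
  define F where "F = (\<lambda>x r p. (\<delta> * r + g x) + H x p)"
  have "continuous_on UNIV (\<lambda>z :: (real ^ 'n) \<times> real \<times> (real ^ 'n). g (fst z))"
    by (rule continuous_on_compose2[OF g(1)]) (auto intro!: continuous_intros)
  moreover have "continuous_on UNIV (\<lambda>z :: (real ^ 'n) \<times> real \<times> (real ^ 'n). H (fst z) (snd (snd z)))"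
    using continuous_on_compose2[OF hamiltonian_continuous[OF H],
        of UNIV "\<lambda>z :: (real ^ 'n) \<times> real \<times> (real ^ 'n). (fst z, snd (snd z))"]
    by (simp add: continuous_on_Pair continuous_on_fst continuous_on_snd continuous_on_id)
  ultimately have F: "continuous_on UNIV (\<lambda>(x, r, p). F x r p)"
    unfolding F_def case_prod_beta by (intro continuous_intros)
  have low: "F x (- (C + 1) / \<delta>) 0 \<le> 0" for x
    using C(2)[of x] \<open>\<delta> > 0\<close> unfolding F_def by simp
  have high: "F x ((C + 1) / \<delta>) 0 > 0" for x
    using C(2)[of x] \<open>\<delta> > 0\<close> unfolding F_def by simp
  have "- (C + 1) / \<delta> \<le> (C + 1) / \<delta>" using C(1) \<open>\<delta> > 0\<close> by (intro divide_right_mono) auto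
  then obtain U L where U: "usc U" "viscosity_subsolution F U"
    and L: "usc (\<lambda>x. - L x)" "viscosity_supersolution F L" and LU: "\<And>x. L x \<le> U x"
    and per: "\<And>k x. (\<And>y. F (y + k) = F y) \<Longrightarrow> U (x + k) = U x"
      "\<And>k x. (\<And>y. F (y + k) = F y) \<Longrightarrow> L (x + k) = L x"
    using perron_method[OF F low high] by blast
  have "F (y + k) = F y" if "\<forall>i. k $ i \<in> \<int>" for y k
    using g(2) H that unfolding F_def hamiltonian_def int_periodic_def by simp
  then have periodic: "int_periodic U" "int_periodic L"
    unfolding int_periodic_def using per by blast+
  obtain x where "\<And>y. U y - L y \<le> U x - L x" "\<delta> * U x + g x \<le> \<delta> * L x + g x"
    using comparison_at_max[OF H discount_continuous[OF g(1)] discount_continuous[OF g(1)]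
        periodic(1) U[unfolded F_def] periodic(2) L[unfolded F_def]] by blast
  then have "U y \<le> L y" for y using \<open>\<delta> > 0\<close> by (smt (verit) mult_le_cancel_left_pos)
  then have "U = L" using LU by (intro ext antisym) auto
  then have "continuous_on UNIV U" using continuous_if_usc U(1) L(1) by blast
  then have "discounted_solution (\<lambda>x p. g x + H x p) \<delta> U"
    using U(2) L(2) periodic(1) \<open>U = L\<close>
    unfolding discounted_solution_def continuous_viscosity_solution_def F_def
    by (simp add: add.assoc)
  then show ?thesis by blast
qed

text \<open>Constants are admissible test functions at the extrema of \<open>u\<close>.\<close>

lemma discounted_solutions_bounded:
  fixes H :: "real ^ 'n \<Rightarrow> real ^ 'n \<Rightarrow> real"
  assumes "hamiltonian H" "continuous_on UNIV g" "int_periodic g"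
  obtains C where "C \<ge> 0"
    "\<And>\<delta> u x. \<delta> > 0 \<Longrightarrow> discounted_solution (\<lambda>x p. g x + H x p) \<delta> u \<Longrightarrow> \<bar>\<delta> * u x\<bar> \<le> C"
proof -
  obtain C where C: "C \<ge> 0" "\<And>x. \<bar>g x + H x 0\<bar> \<le> C"
    using periodic_bound_zero_gradient[OF assms] by blast
  have "\<bar>\<delta> * u x\<bar> \<le> C" if "\<delta> > 0" and u: "discounted_solution (\<lambda>x p. g x + H x p) \<delta> u" for \<delta> u x
  proof -
    note u = discounted_solutionD[OF u]
    have "usc u" "usc (\<lambda>x. - u x)" using u(1) continuous_imp_usc usc_uminus_continuous by auto
    moreover have "int_periodic (\<lambda>x. - u x)" using u(2) unfolding int_periodic_def by simp
    ultimately obtain a b where a: "\<And>y. u y \<le> u a" and b: "\<And>y. - u y \<le> - u b"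
      using periodic_usc_attains_max u(2) by metis
    from subsolutionD[OF u(3) test_function_const[of 0], of a] a
    have "\<delta> * u a + g a + H a 0 \<le> 0" by simp
    moreover from supersolutionD[OF u(4) test_function_const[of 0], of b] b
    have "\<delta> * u b + g b + H b 0 \<ge> 0" by simp
    moreover have "\<delta> * u x \<le> \<delta> * u a" "\<delta> * u b \<le> \<delta> * u x"
      using a[of x] b[of x] \<open>\<delta> > 0\<close> by simp_all
    ultimately show ?thesis using C(2)[of a] C(2)[of b] by linarith
  qed
  then show thesis using that C(1) by blast
qed

lemma discounted_solutions_compare:
  fixes H :: "real ^ 'n \<Rightarrow> real ^ 'n \<Rightarrow> real"
  assumes H: "hamiltonian H" and g: "continuous_on UNIV g"
    and u: "discounted_solution (\<lambda>x p. g x + H x p) \<delta> u"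
    and u': "discounted_solution (\<lambda>x p. g x + H x p) \<delta>' u'"
  obtains x where "\<And>y. u y - u' y \<le> u x - u' x" "\<delta> * u x \<le> \<delta>' * u' x"
proof -
  note u = discounted_solutionD[OF u] and u' = discounted_solutionD[OF u']
  from comparison_at_max[OF H discount_continuous[OF g] discount_continuous[OF g]
      u(2) continuous_imp_usc[OF u(1)] u(3) u'(2) usc_uminus_continuous[OF u'(1)] u'(4)]
  show thesis using that by auto
qed

text \<open>
  At a maximum of \<open>u - u'\<close> the comparison says \<open>\<delta>u \<le> \<delta>'u'\<close>, that is, \<open>\<delta>(u - u') \<le> (\<delta>' - \<delta>)u'\<close>, and the
  right-hand side is controlled by the bound on \<open>\<delta>'u'\<close>.
\<close>

lemma discounted_values_lipschitz:
  fixes H :: "real ^ 'n \<Rightarrow> real ^ 'n \<Rightarrow> real"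
  assumes H: "hamiltonian H" and g: "continuous_on UNIV g"
    and u: "discounted_solution (\<lambda>x p. g x + H x p) \<delta> u"
    and u': "discounted_solution (\<lambda>x p. g x + H x p) \<delta>' u'"
    and "\<delta> > 0" "\<delta>' > 0" and C: "\<And>x. \<bar>\<delta> * u x\<bar> \<le> C" "\<And>x. \<bar>\<delta>' * u' x\<bar> \<le> C"
  shows "\<bar>\<delta> * u y - \<delta>' * u' y\<bar> \<le> 2 * C * \<bar>\<delta> - \<delta>'\<bar> / \<delta>'"
proof -
  have *: "v z - w z \<le> C * \<bar>d - e\<bar> / (d * e)"
    if v: "discounted_solution (\<lambda>x p. g x + H x p) d v"
      and w: "discounted_solution (\<lambda>x p. g x + H x p) e w"
      and "d > 0" "e > 0" and C: "\<And>x. \<bar>e * w x\<bar> \<le> C" for v w d e z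
  proof -
    obtain x where x: "\<And>y. v y - w y \<le> v x - w x" "d * v x \<le> e * w x"
      using discounted_solutions_compare[OF H g v w] by blast
    have "d * (v x - w x) \<le> (e - d) * w x" using x(2) by (simp add: algebra_simps)
    then have "(d * e) * (v x - w x) \<le> (e - d) * (e * w x)"
      using mult_left_mono[of _ _ e] \<open>e > 0\<close> by (fastforce simp: algebra_simps)
    also have "\<dots> \<le> \<bar>e - d\<bar> * \<bar>e * w x\<bar>" by (simp add: abs_mult[symmetric])
    also have "\<dots> \<le> \<bar>e - d\<bar> * C" using C by (intro mult_left_mono) auto
    finally have "v x - w x \<le> C * \<bar>d - e\<bar> / (d * e)"
      using that(3,4) by (simp add: field_simps abs_minus_commute)
    with x(1)[of z] show ?thesis by linarith
  qed
  have "\<bar>u y - u' y\<bar> \<le> C * \<bar>\<delta> - \<delta>'\<bar> / (\<delta> * \<delta>')"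
    using *[OF u u' \<open>\<delta> > 0\<close> \<open>\<delta>' > 0\<close> C(2), of y] *[OF u' u \<open>\<delta>' > 0\<close> \<open>\<delta> > 0\<close> C(1), of y]
    by (simp add: abs_le_iff abs_minus_commute mult.commute)
  then have "\<delta> * \<bar>u y - u' y\<bar> \<le> C * \<bar>\<delta> - \<delta>'\<bar> / \<delta>'"
    using mult_left_mono[of _ _ \<delta>] \<open>\<delta> > 0\<close> by (fastforce simp: field_simps)
  moreover have "\<bar>\<delta> - \<delta>'\<bar> * \<bar>u' y\<bar> \<le> C * \<bar>\<delta> - \<delta>'\<bar> / \<delta>'"
  proof -
    have "\<bar>u' y\<bar> \<le> C / \<delta>'" using C(2)[of y] \<open>\<delta>' > 0\<close> by (simp add: abs_mult field_simps)
    from mult_left_mono[OF this, of "\<bar>\<delta> - \<delta>'\<bar>"] show ?thesis by (simp add: mult.commute)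
  qed
  moreover have "\<delta> * u y - \<delta>' * u' y = \<delta> * (u y - u' y) + (\<delta> - \<delta>') * u' y"
    by (simp add: algebra_simps)
  then have "\<bar>\<delta> * u y - \<delta>' * u' y\<bar> \<le> \<delta> * \<bar>u y - u' y\<bar> + \<bar>\<delta> - \<delta>'\<bar> * \<bar>u' y\<bar>"
    using abs_triangle_ineq[of "\<delta> * (u y - u' y)" "(\<delta> - \<delta>') * u' y"] \<open>\<delta> > 0\<close>
    by (simp add: abs_mult)
  ultimately show ?thesis by simp
qed

section \<open>The recession function\<close>

text \<open>
  Scaling a function scales the gradients of its test functions. With the homogeneity of the
  recession function this relates solutions for \<open>H\<close> and for \<open>H\<^sub>\<infinity>\<close>.
\<close>

lemma subsolution_scale:
  assumes w: "viscosity_subsolution F w" and "c > 0"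
    and FG: "\<And>x p. F x (w x) p \<le> 0 \<Longrightarrow> G x (c * w x) (c *\<^sub>R p) \<le> 0"
  shows "viscosity_subsolution G (\<lambda>x. c * w x)"
proof (rule subsolutionI)
  fix \<phi> D\<phi> x
  assume \<phi>: "test_function \<phi> D\<phi>" and max: "\<forall>\<^sub>F y in nhds x. c * w y - \<phi> y \<le> c * w x - \<phi> x"
  from max have "\<forall>\<^sub>F y in nhds x. w y - (1 / c) * \<phi> y \<le> w x - (1 / c) * \<phi> x"
  proof eventually_elim
    case (elim y)
    from divide_right_mono[OF elim, of c] \<open>c > 0\<close> show ?case by (simp add: diff_divide_distrib)
  qed
  from FG[OF subsolutionD[OF w test_function_scale[OF \<phi>] this]]
  show "G x (c * w x) (D\<phi> x) \<le> 0" using \<open>c > 0\<close> by simp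
qed

lemma supersolution_scale:
  assumes w: "viscosity_supersolution F w" and "c > 0"
    and FG: "\<And>x p. F x (w x) p \<ge> 0 \<Longrightarrow> G x (c * w x) (c *\<^sub>R p) \<ge> 0"
  shows "viscosity_supersolution G (\<lambda>x. c * w x)"
proof (rule supersolutionI)
  fix \<phi> D\<phi> x
  assume \<phi>: "test_function \<phi> D\<phi>" and min: "\<forall>\<^sub>F y in nhds x. c * w y - \<phi> y \<ge> c * w x - \<phi> x"
  from min have "\<forall>\<^sub>F y in nhds x. w y - (1 / c) * \<phi> y \<ge> w x - (1 / c) * \<phi> x"
  proof eventually_elim
    case (elim y)
    from divide_right_mono[OF elim, of c] \<open>c > 0\<close> show ?case by (simp add: diff_divide_distrib)
  qed
  from FG[OF supersolutionD[OF w test_function_scale[OF \<phi>] this]]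
  show "G x (c * w x) (D\<phi> x) \<ge> 0" using \<open>c > 0\<close> by simp
qed

lemma recession_function_zero:
  assumes "recession_function H Hinf"
  shows "Hinf x 0 = 0"
proof -
  have "Hinf x (2 *\<^sub>R 0) = 2 * Hinf x 0"
    using assms unfolding recession_function_def by (meson zero_less_numeral)
  then show ?thesis by simp
qed

text \<open>The functions \<open>H(x, \<nu>p) / \<nu>\<close> converge to the recession function uniformly.\<close>

lemma recession_function_continuous:
  fixes H :: "real ^ 'n \<Rightarrow> real ^ 'n \<Rightarrow> real"
  assumes H: "continuous_on UNIV (\<lambda>(x, p). H x p)" and "recession_function H Hinf"
  shows "continuous_on UNIV (\<lambda>(x, p). Hinf x p)"
proof -
  obtain M where hom: "\<And>x p \<nu>. \<nu> > 0 \<Longrightarrow> Hinf x (\<nu> *\<^sub>R p) = \<nu> * Hinf x p"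
    and M: "M \<ge> 0" "\<And>x p. \<bar>H x p - Hinf x p\<bar> \<le> M"
    using assms(2) unfolding recession_function_def by blast
  have lim: "uniform_limit UNIV (\<lambda>n z. H (fst z) (real (Suc n) *\<^sub>R snd z) / real (Suc n))
      (\<lambda>z. Hinf (fst z) (snd z)) sequentially"
  proof (rule uniform_limitI)
    fix e :: real assume "e > 0"
    have "(\<lambda>n. M * inverse (real (Suc n))) \<longlonglongrightarrow> 0"
      using tendsto_mult[OF tendsto_const LIMSEQ_inverse_real_of_nat, of M] by simp
    then have "\<forall>\<^sub>F n in sequentially. M * inverse (real (Suc n)) < e"
      using \<open>e > 0\<close> by (rule order_tendstoD)
    then show "\<forall>\<^sub>F n in sequentially. \<forall>z\<in>UNIV.
        dist (H (fst z) (real (Suc n) *\<^sub>R snd z) / real (Suc n)) (Hinf (fst z) (snd z)) < e"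
    proof (eventually_elim, intro ballI)
      fix n and z :: "(real ^ 'n) \<times> (real ^ 'n)"
      assume less: "M * inverse (real (Suc n)) < e"
      have pos: "real (Suc n) > 0" by simp
      then have "H (fst z) (real (Suc n) *\<^sub>R snd z) / real (Suc n) - Hinf (fst z) (snd z)
          = (H (fst z) (real (Suc n) *\<^sub>R snd z) - Hinf (fst z) (real (Suc n) *\<^sub>R snd z)) / real (Suc n)"
        unfolding hom[OF pos] by (simp add: diff_divide_distrib)
      then have "dist (H (fst z) (real (Suc n) *\<^sub>R snd z) / real (Suc n)) (Hinf (fst z) (snd z))
          = \<bar>H (fst z) (real (Suc n) *\<^sub>R snd z) - Hinf (fst z) (real (Suc n) *\<^sub>R snd z)\<bar> / real (Suc n)"
        unfolding dist_real_def by (simp only: abs_divide abs_of_pos[OF pos])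
      also have "\<dots> \<le> M / real (Suc n)" using M(2) pos by (intro divide_right_mono) auto
      finally show "dist (H (fst z) (real (Suc n) *\<^sub>R snd z) / real (Suc n)) (Hinf (fst z) (snd z)) < e"
        using less by (simp add: divide_inverse)
    qed
  qed
  have "continuous_on UNIV (\<lambda>z. H (fst z) (real (Suc n) *\<^sub>R snd z) / real (Suc n))" for n
  proof -
    have "continuous_on UNIV (\<lambda>z. case (fst z, real (Suc n) *\<^sub>R snd z) of (x, p) \<Rightarrow> H x p)"
      by (rule continuous_on_compose2[OF H]) (auto intro!: continuous_intros)
    then have "continuous_on UNIV (\<lambda>z. H (fst z) (real (Suc n) *\<^sub>R snd z))" by simp
    then show ?thesis by (intro continuous_intros) auto
  qed
  then have "continuous_on UNIV (\<lambda>z. Hinf (fst z) (snd z))"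
    by (intro uniform_limit_theorem[OF _ lim] always_eventually allI) auto
  then show ?thesis by (simp add: case_prod_beta)
qed

text \<open>
  Since the error is bounded, its supremum over the space is finite and serves as the error
  sequence in the stability lemma below.
\<close>

lemma uniform_limit_error_bound:
  fixes f :: "nat \<Rightarrow> 'a \<Rightarrow> real"
  assumes lim: "uniform_limit UNIV f l sequentially" and bound: "\<And>n y. \<bar>f n y - l y\<bar> \<le> B"
  obtains e where "e \<longlonglongrightarrow> 0" "\<And>n y. \<bar>f n y - l y\<bar> \<le> e n"
proof
  define e where "e n = (SUP y. \<bar>f n y - l y\<bar>)" for n
  have bdd: "bdd_above (range (\<lambda>y. \<bar>f n y - l y\<bar>))" for n
    by (rule bdd_aboveI[of _ B]) (use bound in auto)
  show le: "\<bar>f n y - l y\<bar> \<le> e n" for n y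
    unfolding e_def using bdd by (rule cSUP_upper[OF UNIV_I])
  have nonneg: "0 \<le> e n" for n using le[of n undefined] by linarith
  show "e \<longlonglongrightarrow> 0"
  proof (rule tendstoI)
    fix c :: real assume "c > 0"
    then have "\<forall>\<^sub>F n in sequentially. \<forall>y\<in>UNIV. dist (f n y) (l y) < c / 2"
      using uniform_limitD[OF lim, of "c / 2"] by simp
    then show "\<forall>\<^sub>F n in sequentially. dist (e n) 0 < c"
    proof eventually_elim
      case (elim n)
      have "e n \<le> c / 2"
        unfolding e_def by (rule cSUP_least) (use elim in \<open>auto simp: dist_real_def less_imp_le\<close>)
      then show ?case using nonneg[of n] \<open>c > 0\<close> by simp
    qed
  qed
qed

text \<open>
  Multiplying the equation of \<open>u\<^sub>\<delta>\<close> by \<open>\<delta>\<close> gives an equation for \<open>\<delta>u\<^sub>\<delta>\<close> in which \<open>H\<close> is replaced by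
  \<open>\<delta>H(x, p/\<delta>)\<close>, and this differs from the recession function by at most \<open>\<delta>M\<close>.
\<close>

lemma discounted_limit_subsolution:
  fixes H Hinf :: "real ^ 'n \<Rightarrow> real ^ 'n \<Rightarrow> real"
  assumes Hinf: "continuous_on UNIV (\<lambda>(x, p). Hinf x p)"
    and hom: "\<And>x p \<nu>. \<nu> > 0 \<Longrightarrow> Hinf x (\<nu> *\<^sub>R p) = \<nu> * Hinf x p"
    and M: "\<And>x p. Hinf x p \<le> H x p + M"
    and g: "continuous_on UNIV g"
    and d: "\<And>n. d n > 0" "d \<longlonglongrightarrow> 0"
    and u: "\<And>n. continuous_on UNIV (u n)"
      "\<And>n. viscosity_subsolution (\<lambda>x r p. (d n * r + g x) + H x p) (u n)"
    and e: "e \<longlonglongrightarrow> 0" "\<And>n y. \<bar>d n * u n y - w y\<bar> \<le> e n"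
  shows "viscosity_subsolution (\<lambda>x r p. Hinf x p) w"
proof (rule subsolution_relaxed_limit)
  fix x
  define F where "F n = (\<lambda>x r p. d n * (r + g x - M) + Hinf x p)" for n
  have sub: "viscosity_subsolution (F n) (\<lambda>y. d n * u n y)" for n
  proof (rule subsolution_scale[OF u(2) d(1)])
    fix x p assume "(d n * u n x + g x) + H x p \<le> 0"
    then have "d n * u n x + g x - M + Hinf x p \<le> 0" using M[of x p] by linarith
    from mult_left_mono[OF this, of "d n"] d(1)[of n]
    show "F n x (d n * u n x) (d n *\<^sub>R p) \<le> 0"
      unfolding F_def hom[OF d(1)] by (simp add: algebra_simps)
  qed
  have usc: "usc (\<lambda>y. d n * u n y)" for n
    by (intro continuous_imp_usc continuous_intros u)
  have le: "d n * u n y \<le> w y + e n" for n y using e(2)[of n y] by linarith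
  have ux: "(\<lambda>n. d n * u n x) \<longlonglongrightarrow> w x"
    by (rule LIM_zero_cancel, rule Lim_null_comparison[OF _ e(1)])
      (use e(2) in \<open>auto intro!: always_eventually\<close>)
  have lim: "Hinf x q \<le> 0"
    if "z \<longlonglongrightarrow> x" "r \<longlonglongrightarrow> w x" "p \<longlonglongrightarrow> q" and le: "\<forall>\<^sub>F n in sequentially. F n (z n) (r n) (p n) \<le> 0"
    for z r p q
  proof -
    have "(\<lambda>n. Hinf (z n) (p n)) \<longlonglongrightarrow> Hinf x q"
      using continuous_on_tendsto_compose[OF Hinf tendsto_Pair[OF that(1,3)]] by simp
    moreover have "(\<lambda>n. g (z n)) \<longlonglongrightarrow> g x"
      using continuous_on_tendsto_compose[OF g that(1)] by simp
    ultimately have "(\<lambda>n. F n (z n) (r n) (p n)) \<longlonglongrightarrow> 0 * (w x + g x - M) + Hinf x q"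
      unfolding F_def by (intro tendsto_intros d that)
    from tendsto_upperbound[OF this le] show ?thesis by simp
  qed
  show "\<exists>F u e y. (\<forall>n. usc (u n) \<and> viscosity_subsolution (F n) (u n) \<and>
        (\<forall>y. u n y \<le> w y + e n)) \<and> e \<longlonglongrightarrow> 0 \<and> y \<longlonglongrightarrow> x \<and> (\<lambda>n. u n (y n)) \<longlonglongrightarrow> w x \<and>
      (\<forall>z r p q. z \<longlonglongrightarrow> x \<longrightarrow> r \<longlonglongrightarrow> w x \<longrightarrow> p \<longlonglongrightarrow> q \<longrightarrow>
        (\<forall>\<^sub>F n in sequentially. F n (z n) (r n) (p n) \<le> 0) \<longrightarrow> Hinf x q \<le> 0)"
    using sub usc le e(1) ux lim by - (rule exI[of _ F], rule exI[of _ "\<lambda>n y. d n * u n y"],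
        rule exI[of _ e], rule exI[of _ "\<lambda>_. x"], intro conjI, blast, simp, simp, simp, blast)
qed

section \<open>Consequences of unique ergodicity\<close>

text \<open>
  Let \<open>w\<close> solve \<open>H\<^sub>\<infinity>(x, Dw) = 0\<close>. Then so does \<open>z = Kw/\<delta>\<close> for every \<open>K > 0\<close>, and therefore
  \<open>\<bar>H(x, Dz)\<bar> \<le> M\<close>. With the source term \<open>g = -Kw\<close> this says that \<open>z\<close> solves the discounted equation
  up to an error \<open>M\<close>, so that \<open>\<delta>u\<^sub>\<delta>\<close> stays within \<open>M\<close> of \<open>Kw\<close>. Unique ergodicity makes the limit
  of \<open>\<delta>u\<^sub>\<delta>\<close> constant; hence the oscillation of \<open>w\<close> is at most \<open>2M/K\<close>, for every \<open>K\<close>.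
\<close>

lemma discounted_value_near_recession_solution:
  fixes H Hinf :: "real ^ 'n \<Rightarrow> real ^ 'n \<Rightarrow> real"
  assumes H: "hamiltonian H"
    and hom: "\<And>x p \<nu>. \<nu> > 0 \<Longrightarrow> Hinf x (\<nu> *\<^sub>R p) = \<nu> * Hinf x p"
    and M: "\<And>x p. \<bar>H x p - Hinf x p\<bar> \<le> M"
    and w: "continuous_viscosity_solution (\<lambda>x r p. Hinf x p) w" "int_periodic w"
    and "K > 0" "\<delta> > 0" and u: "discounted_solution (\<lambda>x p. - K * w x + H x p) \<delta> u"
  shows "\<bar>\<delta> * u y - K * w y\<bar> \<le> M"
proof -
  note u = discounted_solutionD[OF u]
  have cont: "continuous_on UNIV w" using w(1) unfolding continuous_viscosity_solution_def by blast
  define z where "z = (\<lambda>x. (K / \<delta>) * w x)"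
  have pos: "K / \<delta> > 0" using \<open>K > 0\<close> \<open>\<delta> > 0\<close> by simp
  have \<delta>z: "\<delta> * z x = K * w x" for x unfolding z_def using \<open>\<delta> > 0\<close> by simp
  have z: "continuous_on UNIV z" "int_periodic z"
    unfolding z_def using cont w(2) \<open>\<delta> > 0\<close> by (auto intro!: continuous_intros simp: int_periodic_def)
  have sub: "viscosity_subsolution (\<lambda>x r p. - M + H x p) z"
    unfolding z_def
  proof (rule subsolution_scale[OF _ pos])
    show "viscosity_subsolution (\<lambda>x r p. Hinf x p) w"
      using w(1) unfolding continuous_viscosity_solution_def by blast
    fix x p assume "Hinf x p \<le> 0"
    then have "Hinf x ((K / \<delta>) *\<^sub>R p) \<le> 0"
      unfolding hom[OF pos] using pos by (intro mult_nonneg_nonpos) auto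
    then show "- M + H x ((K / \<delta>) *\<^sub>R p) \<le> 0" using M[of x "(K / \<delta>) *\<^sub>R p"] by linarith
  qed
  have super: "viscosity_supersolution (\<lambda>x r p. M + H x p) z"
    unfolding z_def
  proof (rule supersolution_scale[OF _ pos])
    show "viscosity_supersolution (\<lambda>x r p. Hinf x p) w"
      using w(1) unfolding continuous_viscosity_solution_def by blast
    fix x p assume "Hinf x p \<ge> 0"
    then have "Hinf x ((K / \<delta>) *\<^sub>R p) \<ge> 0"
      unfolding hom[OF pos] using pos by (intro mult_nonneg_nonneg) auto
    then show "M + H x ((K / \<delta>) *\<^sub>R p) \<ge> 0" using M[of x "(K / \<delta>) *\<^sub>R p"] by linarith
  qed
  have g: "continuous_on UNIV (\<lambda>x. - K * w x)" by (intro continuous_intros cont)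
  have const: "continuous_on UNIV (\<lambda>(x :: real ^ 'n, r :: real). c)" for c :: real
    by (simp add: case_prod_beta)
  obtain a where a: "\<And>y. z y - u y \<le> z a - u a" "- M \<le> \<delta> * u a + - K * w a"
    using comparison_at_max[OF H const discount_continuous[OF g] z(2) continuous_imp_usc[OF z(1)] sub
        u(2) usc_uminus_continuous[OF u(1)] u(4)] by blast
  obtain b where b: "\<And>y. u y - z y \<le> u b - z b" "\<delta> * u b + - K * w b \<le> M"
    using comparison_at_max[OF H discount_continuous[OF g] const u(2) continuous_imp_usc[OF u(1)] u(3)
        z(2) usc_uminus_continuous[OF z(1)] super] by blast
  have "\<delta> * (z y - u y) \<le> \<delta> * (z a - u a)" "\<delta> * (u y - z y) \<le> \<delta> * (u b - z b)"
    using a(1)[of y] b(1)[of y] \<open>\<delta> > 0\<close> by (intro mult_left_mono; simp)+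
  then show ?thesis using a(2) b(2) \<delta>z by (simp add: right_diff_distrib)
qed

lemma uniquely_ergodic_imp_strong_maximum_principle:
  fixes H Hinf :: "real ^ 'n \<Rightarrow> real ^ 'n \<Rightarrow> real"
  assumes H: "hamiltonian H" and rec: "recession_function H Hinf" and erg: "uniquely_ergodic H"
  shows "strong_maximum_principle Hinf"
  unfolding strong_maximum_principle_def
proof (intro allI iffI)
  fix w :: "real ^ 'n \<Rightarrow> real"
  assume "\<exists>c. w = (\<lambda>_. c)"
  then obtain c where "w = (\<lambda>_. c)" by blast
  then show "continuous_viscosity_solution (\<lambda>x r p. Hinf x p) w \<and> int_periodic w"
    unfolding continuous_viscosity_solution_def int_periodic_def
    by (auto intro!: subsolution_const supersolution_const simp: recession_function_zero[OF rec])
next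
  fix w :: "real ^ 'n \<Rightarrow> real"
  assume "continuous_viscosity_solution (\<lambda>x r p. Hinf x p) w \<and> int_periodic w"
  then have w: "continuous_viscosity_solution (\<lambda>x r p. Hinf x p) w" "int_periodic w"
    and cont: "continuous_on UNIV w" unfolding continuous_viscosity_solution_def by auto
  obtain M where hom: "\<And>x p \<nu>. \<nu> > 0 \<Longrightarrow> Hinf x (\<nu> *\<^sub>R p) = \<nu> * Hinf x p"
    and M: "M \<ge> 0" "\<And>x p. \<bar>H x p - Hinf x p\<bar> \<le> M"
    using rec unfolding recession_function_def by blast
  have osc: "K * \<bar>w x - w y\<bar> \<le> 2 * M" if "K > 0" for K x y
  proof -
    have g: "continuous_on UNIV (\<lambda>x. - K * w x)" "int_periodic (\<lambda>x. - K * w x)"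
      using w(2) by (auto intro!: continuous_intros cont simp: int_periodic_def)
    obtain u where u: "\<And>\<delta>. \<delta> > 0 \<Longrightarrow> discounted_solution (\<lambda>x p. - K * w x + H x p) \<delta> (u \<delta>)"
      using discounted_solution_exists[OF H g] by metis
    have "ergodic (\<lambda>x p. - K * w x + H x p)"
      using erg g unfolding uniquely_ergodic_def by blast
    then obtain c where c: "uniform_limit UNIV (\<lambda>\<delta> x. \<delta> * u \<delta> x) (\<lambda>_. c) (at_right 0)"
      using u unfolding ergodic_def by blast
    have "\<bar>c - K * w x\<bar> \<le> M" for x
    proof (rule tendsto_upperbound)
      show "((\<lambda>\<delta>. \<bar>\<delta> * u \<delta> x - K * w x\<bar>) \<longlongrightarrow> \<bar>c - K * w x\<bar>) (at_right 0)"
        by (intro tendsto_intros tendsto_uniform_limitI[OF c]) simp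
      have "\<forall>\<^sub>F \<delta> :: real in at_right 0. \<delta> > 0" by (simp add: eventually_at_right_less)
      then show "\<forall>\<^sub>F \<delta> in at_right 0. \<bar>\<delta> * u \<delta> x - K * w x\<bar> \<le> M"
        by eventually_elim
          (rule discounted_value_near_recession_solution[OF H hom M(2) w \<open>K > 0\<close> _ u])
    qed simp
    from this[of x] this[of y] have "\<bar>K * w x - K * w y\<bar> \<le> 2 * M" by linarith
    then show ?thesis using that by (simp add: abs_mult right_diff_distrib[symmetric])
  qed
  have "w x = w 0" for x
  proof (rule ccontr)
    assume "w x \<noteq> w 0"
    then have "\<bar>w x - w 0\<bar> > 0" by simp
    with osc[of "(2 * M + 1) / \<bar>w x - w 0\<bar>" x 0] M(1) show False by simp
  qed
  then show "\<exists>c. w = (\<lambda>_. c)" by blast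
qed

text \<open>
  Near \<open>\<delta> = 0\<close> the functions \<open>\<delta>u\<^sub>\<delta>\<close> are nearly constant; away from \<open>0\<close> they depend continuously on \<open>\<delta>\<close>
  in the uniform norm. A sequence of parameters violating equicontinuity therefore has no
  limit point in \<open>[0, 1]\<close>.
\<close>

lemma uniquely_ergodic_imp_structural_equicontinuity:
  fixes H :: "real ^ 'n \<Rightarrow> real ^ 'n \<Rightarrow> real"
  assumes H: "hamiltonian H" and erg: "uniquely_ergodic H"
  shows "structural_equicontinuity H"
  unfolding structural_equicontinuity_def
proof (intro allI impI)
  fix g :: "real ^ 'n \<Rightarrow> real" and u
  assume g: "continuous_on UNIV g" "int_periodic g"
    and "\<forall>\<delta>>0. discounted_solution (\<lambda>x p. g x + H x p) \<delta> (u \<delta>)"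
  then have u: "\<And>\<delta>. \<delta> > 0 \<Longrightarrow> discounted_solution (\<lambda>x p. g x + H x p) \<delta> (u \<delta>)" by blast
  define v where "v \<delta> x = \<delta> * u \<delta> x" for \<delta> x
  obtain c where c: "uniform_limit UNIV v (\<lambda>_. c) (at_right 0)"
    using erg g u unfolding uniquely_ergodic_def ergodic_def v_def by blast
  obtain C where C: "C \<ge> 0" "\<And>\<delta> u x. \<delta> > 0 \<Longrightarrow>
      discounted_solution (\<lambda>x p. g x + H x p) \<delta> u \<Longrightarrow> \<bar>\<delta> * u x\<bar> \<le> C"
    using discounted_solutions_bounded[OF H g] by blast
  have lip: "\<bar>v \<delta> y - v d y\<bar> \<le> 2 * C * \<bar>\<delta> - d\<bar> / d" if "\<delta> > 0" "d > 0" for \<delta> d y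
    unfolding v_def
    by (rule discounted_values_lipschitz[OF H g(1) u u]) (use that C(2) u in auto)
  have main: "\<exists>\<eta>>0. \<forall>\<delta> y. 0 < \<delta> \<longrightarrow> \<delta> \<le> 1 \<longrightarrow> dist y x < \<eta> \<longrightarrow> dist (v \<delta> y) (v \<delta> x) < \<epsilon>"
    if "\<epsilon> > 0" for x \<epsilon>
  proof (rule ccontr)
    assume *: "\<not> ?thesis"
    have "\<exists>\<delta> y. 0 < \<delta> \<and> \<delta> \<le> 1 \<and> dist y x < inverse (Suc n) \<and> dist (v \<delta> y) (v \<delta> x) \<ge> \<epsilon>" for n
    proof -
      have "inverse (real (Suc n)) > 0" by simp
      with * show ?thesis by (meson not_le)
    qed
    then obtain \<delta> y where \<delta>: "\<And>n. 0 < \<delta> n" "\<And>n. \<delta> n \<le> 1"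
      and y: "\<And>n. dist (y n) x < inverse (Suc n)"
      and far: "\<And>n. dist (v (\<delta> n) (y n)) (v (\<delta> n) x) \<ge> \<epsilon>" by metis
    have "\<delta> n \<in> {0..1}" for n using \<delta>[of n] by simp
    then obtain d r where d: "d \<in> {0..1}" "strict_mono (r :: nat \<Rightarrow> nat)" "(\<delta> \<circ> r) \<longlonglongrightarrow> d"
      using compact_Icc[of "0 :: real" 1] unfolding compact_def by metis
    define \<delta>' where "\<delta>' n = \<delta> (r n)" for n
    have lim: "\<delta>' \<longlonglongrightarrow> d" using d(3) unfolding \<delta>'_def by (simp add: o_def)
    have pos: "\<delta>' n > 0" for n using \<delta>(1) unfolding \<delta>'_def by simp
    have "y \<longlonglongrightarrow> x"
      by (rule metric_tendsto_imp_tendsto[OF LIMSEQ_inverse_real_of_nat])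
        (use y in \<open>auto intro!: always_eventually less_imp_le\<close>)
    then have yr: "(\<lambda>n. y (r n)) \<longlonglongrightarrow> x"
      using LIMSEQ_subseq_LIMSEQ[OF _ d(2)] by (simp add: o_def)
    have "\<exists>n. dist (v (\<delta>' n) (y (r n))) (v (\<delta>' n) x) < \<epsilon>"
    proof (cases "d = 0")
      case True
      have "filterlim \<delta>' (at_right 0) sequentially"
        using lim True pos by (simp add: filterlim_at less_imp_neq[symmetric])
      moreover have "\<forall>\<^sub>F \<delta> in at_right 0. \<forall>y\<in>UNIV. dist (v \<delta> y) c < \<epsilon> / 2"
        using uniform_limitD[OF c, of "\<epsilon> / 2"] that by simp
      ultimately have "\<forall>\<^sub>F n in sequentially. \<forall>y\<in>UNIV. dist (v (\<delta>' n) y) c < \<epsilon> / 2"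
        by (rule eventually_compose_filterlim[rotated])
      then obtain n where "\<And>y. dist (v (\<delta>' n) y) c < \<epsilon> / 2"
        using eventually_happens'[OF sequentially_bot] by blast
      then show ?thesis using dist_triangle_half_l by blast
    next
      case False
      then have "d > 0" using d(1) by simp
      have vd: "continuous_on UNIV (v d)"
        unfolding v_def using discounted_solutionD(1)[OF u[OF \<open>d > 0\<close>]]
        by (intro continuous_intros)
      have lim0: "(\<lambda>n. 2 * (2 * C * \<bar>\<delta>' n - d\<bar> / d) + \<bar>v d (y (r n)) - v d x\<bar>)
          \<longlonglongrightarrow> 2 * (2 * C * \<bar>d - d\<bar> / d) + \<bar>v d x - v d x\<bar>"
        using continuous_on_tendsto_compose[OF vd yr] \<open>d > 0\<close>
        by (intro tendsto_intros lim) auto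
      have "\<forall>\<^sub>F n in sequentially. 2 * (2 * C * \<bar>\<delta>' n - d\<bar> / d) + \<bar>v d (y (r n)) - v d x\<bar> < \<epsilon>"
        by (rule order_tendstoD(2)[OF lim0]) (use that in simp)
      then obtain n where n: "2 * (2 * C * \<bar>\<delta>' n - d\<bar> / d) + \<bar>v d (y (r n)) - v d x\<bar> < \<epsilon>"
        using eventually_happens'[OF sequentially_bot] by blast
      have "dist (v (\<delta>' n) (y (r n))) (v (\<delta>' n) x) < \<epsilon>"
        using n lip[OF pos[of n] \<open>d > 0\<close>, of "y (r n)"] lip[OF pos[of n] \<open>d > 0\<close>, of x]
        unfolding dist_real_def by linarith
      then show ?thesis by blast
    qed
    then show False using far unfolding \<delta>'_def by (meson not_le)
  qed
  show "equicontinuous {\<lambda>x. \<delta> * u \<delta> x |\<delta>. 0 < \<delta> \<and> \<delta> \<le> 1}"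
    unfolding equicontinuous_def
  proof (intro allI impI)
    fix x and \<epsilon> :: real assume "0 < \<epsilon>"
    from main[OF this, of x] obtain \<eta> where "\<eta> > 0"
      and \<eta>: "\<And>\<delta> y. 0 < \<delta> \<Longrightarrow> \<delta> \<le> 1 \<Longrightarrow> dist y x < \<eta> \<Longrightarrow> dist (v \<delta> y) (v \<delta> x) < \<epsilon>" by blast
    then show "\<exists>\<eta>>0. \<forall>f\<in>{\<lambda>x. \<delta> * u \<delta> x |\<delta>. 0 < \<delta> \<and> \<delta> \<le> 1}.
        \<forall>y. dist y x < \<eta> \<longrightarrow> dist (f y) (f x) < \<epsilon>"
      unfolding v_def by (intro exI[of _ \<eta>]) blast
  qed
qed

section \<open>Sufficiency of the two assertions\<close>

text \<open>
  The supersolution half is the subsolution half for \<open>-H(x, -p)\<close>, whose recession function is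
  \<open>-H\<^sub>\<infinity>(x, -p)\<close>.
\<close>

lemma discounted_limit_solution:
  fixes H Hinf :: "real ^ 'n \<Rightarrow> real ^ 'n \<Rightarrow> real"
  assumes H: "hamiltonian H" and rec: "recession_function H Hinf" and g: "continuous_on UNIV g"
    and d: "\<And>n. d n > 0" "d \<longlonglongrightarrow> 0"
    and u: "\<And>n. discounted_solution (\<lambda>x p. g x + H x p) (d n) (u n)"
    and e: "e \<longlonglongrightarrow> 0" "\<And>n y. \<bar>d n * u n y - w y\<bar> \<le> e n"
  shows "viscosity_subsolution (\<lambda>x r p. Hinf x p) w" "viscosity_supersolution (\<lambda>x r p. Hinf x p) w"
proof -
  obtain M where hom: "\<And>x p \<nu>. \<nu> > 0 \<Longrightarrow> Hinf x (\<nu> *\<^sub>R p) = \<nu> * Hinf x p"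
    and M: "M \<ge> 0" "\<And>x p. \<bar>H x p - Hinf x p\<bar> \<le> M"
    using rec unfolding recession_function_def by blast
  have cont: "continuous_on UNIV (\<lambda>(x, p). Hinf x p)"
    using recession_function_continuous[OF hamiltonian_continuous[OF H] rec] .
  have M': "Hinf x p \<le> H x p + M" "- Hinf x (- p) \<le> - H x (- p) + M" for x p
    using M(2)[of x p] M(2)[of x "- p"] by linarith+
  note u = discounted_solutionD[OF u]
  show "viscosity_subsolution (\<lambda>x r p. Hinf x p) w"
    by (rule discounted_limit_subsolution[OF cont hom M'(1) g d u(1) u(3) e])
  have "viscosity_subsolution (\<lambda>x r p. - Hinf x (- p)) (\<lambda>x. - w x)"
  proof (rule discounted_limit_subsolution[where H = "\<lambda>x p. - H x (- p)" and g = "\<lambda>x. - g x"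
        and u = "\<lambda>n x. - u n x" and d = d and e = e and M = M])
    have "continuous_on UNIV (\<lambda>z :: (real ^ 'n) \<times> (real ^ 'n). case (fst z, - snd z) of (x, p) \<Rightarrow> Hinf x p)"
      by (rule continuous_on_compose2[OF cont]) (auto intro!: continuous_intros)
    then have "continuous_on UNIV (\<lambda>z :: (real ^ 'n) \<times> (real ^ 'n). - Hinf (fst z) (- snd z))"
      by (intro continuous_on_minus) simp
    then show "continuous_on UNIV (\<lambda>(x, p). - Hinf x (- p))" by (simp add: case_prod_beta)
    show "- Hinf x (- (\<nu> *\<^sub>R p)) = \<nu> * - Hinf x (- p)" if "\<nu> > 0" for x p \<nu>
      using hom[OF that, of x "- p"] by simp
    show "- Hinf x (- p) \<le> - H x (- p) + M" for x p by (rule M'(2))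
    show "continuous_on UNIV (\<lambda>x. - g x)" "continuous_on UNIV (\<lambda>x. - u n x)" for n
      using g u(1) by (auto intro: continuous_on_minus)
    show "viscosity_subsolution (\<lambda>x r p. (d n * r + - g x) + - H x (- p)) (\<lambda>x. - u n x)" for n
      using u(4)[of n] unfolding supersolution_iff_subsolution_uminus by (simp add: algebra_simps)
    show "\<bar>d n * - u n y - - w y\<bar> \<le> e n" for n y using e(2)[of n y] by (simp add: abs_minus_commute)
  qed (use d e in auto)
  then show "viscosity_supersolution (\<lambda>x r p. Hinf x p) w"
    unfolding supersolution_iff_subsolution_uminus by simp
qed

text \<open>Uniform convergence on the unit cube propagates to the whole space by periodicity.\<close>

lemma periodic_Arzela_Ascoli:
  fixes f :: "nat \<Rightarrow> real ^ 'n \<Rightarrow> real"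
  assumes per: "\<And>n. int_periodic (f n)" and bound: "\<And>n x. \<bar>f n x\<bar> \<le> C"
    and equi: "equicontinuous (range f)"
  obtains w k where "continuous_on UNIV w" "int_periodic w" "strict_mono (k :: nat \<Rightarrow> nat)"
    "uniform_limit UNIV (\<lambda>n. f (k n)) w sequentially"
proof -
  obtain G k where k: "strict_mono (k :: nat \<Rightarrow> nat)"
    and G: "\<And>e. 0 < e \<Longrightarrow> \<exists>N. \<forall>n x. n \<ge> N \<and> x \<in> cbox 0 1 \<longrightarrow> norm (f (k n) x - G x) < e"
  proof (rule Arzela_Ascoli[of "cbox 0 (1 :: real ^ 'n)" f C])
    fix x :: "real ^ 'n" and e :: real assume "0 < e"
    then obtain \<eta> where "\<eta> > 0" "\<And>n y. dist y x < \<eta> \<Longrightarrow> dist (f n y) (f n x) < e"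
      using equi unfolding equicontinuous_def by (metis rangeI)
    then show "\<exists>d>0. \<forall>n y. y \<in> cbox 0 1 \<and> norm (x - y) < d \<longrightarrow> norm (f n x - f n y) < e"
      by (intro exI[of _ \<eta>]) (auto simp: dist_norm norm_minus_commute abs_minus_commute)
  qed (use bound in auto)
  have "\<exists>j. (\<forall>i. j $ i \<in> \<int>) \<and> x + j \<in> cbox 0 1" for x :: "real ^ 'n"
    using unit_cube_representative[of x] by blast
  then obtain j where j: "\<And>x i. j x $ i \<in> \<int>" "\<And>x :: real ^ 'n. x + j x \<in> cbox 0 1" by metis
  define w where "w x = G (x + j x)" for x
  have unif: "uniform_limit UNIV (\<lambda>n. f (k n)) w sequentially"
  proof (rule uniform_limitI)
    fix e :: real assume "e > 0"
    then obtain N where N: "\<And>n x. n \<ge> N \<Longrightarrow> x \<in> cbox 0 1 \<Longrightarrow> norm (f (k n) x - G x) < e"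
      using G by blast
    have "dist (f (k n) x) (w x) < e" if "n \<ge> N" for n x
      using N[OF that j(2)[of x]] int_periodicD[OF per[of "k n"] j(1)[of x], of x]
      unfolding w_def dist_norm by simp
    then show "\<forall>\<^sub>F n in sequentially. \<forall>x\<in>UNIV. dist (f (k n) x) (w x) < e"
      unfolding eventually_sequentially by blast
  qed
  have cont: "continuous_on UNIV (f n)" for n
    unfolding continuous_on_iff
  proof (intro ballI allI impI)
    fix x and e :: real assume "0 < e"
    then show "\<exists>d>0. \<forall>x'\<in>UNIV. dist x' x < d \<longrightarrow> dist (f n x') (f n x) < e"
      using equi unfolding equicontinuous_def by (metis rangeI)
  qed
  have "continuous_on UNIV w"
    by (rule uniform_limit_theorem[OF _ unif]) (auto intro!: always_eventually cont)
  moreover have "int_periodic w"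
    unfolding int_periodic_def
  proof (intro allI impI)
    fix x i :: "real ^ 'n" assume "\<forall>l. i $ l \<in> \<int>"
    then have "f n (x + i) = f n x" for n using int_periodicD[OF per] by blast
    then have "(\<lambda>n. f (k n) (x + i)) \<longlonglongrightarrow> w x"
      using tendsto_uniform_limitI[OF unif, of x] by simp
    moreover have "(\<lambda>n. f (k n) (x + i)) \<longlonglongrightarrow> w (x + i)"
      using tendsto_uniform_limitI[OF unif, of "x + i"] by simp
    ultimately show "w (x + i) = w x" using LIMSEQ_unique by blast
  qed
  ultimately show thesis using that k unif by blast
qed

text \<open>
  Otherwise \<open>\<delta>u\<^sub>\<delta>\<close> would oscillate by more than \<open>\<epsilon>\<close> along a sequence \<open>\<delta> \<rightarrow> 0\<close>, whereas a subsequence converges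
  uniformly to a solution of the recession equation, which is constant.
\<close>

lemma discounted_oscillation_vanishes:
  fixes H Hinf :: "real ^ 'n \<Rightarrow> real ^ 'n \<Rightarrow> real"
  assumes H: "hamiltonian H" and rec: "recession_function H Hinf"
    and smp: "strong_maximum_principle Hinf"
    and g: "continuous_on UNIV g" "int_periodic g"
    and u: "\<And>\<delta>. \<delta> > 0 \<Longrightarrow> discounted_solution (\<lambda>x p. g x + H x p) \<delta> (u \<delta>)"
    and equi: "equicontinuous {\<lambda>x. \<delta> * u \<delta> x | \<delta>. 0 < \<delta> \<and> \<delta> \<le> 1}"
    and "\<epsilon> > 0"
  shows "\<exists>\<delta>0>0. \<forall>\<delta> x y. 0 < \<delta> \<longrightarrow> \<delta> < \<delta>0 \<longrightarrow> \<bar>\<delta> * u \<delta> x - \<delta> * u \<delta> y\<bar> \<le> \<epsilon>"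
proof (rule ccontr)
  assume *: "\<not> ?thesis"
  have "\<exists>\<delta> x y. 0 < \<delta> \<and> \<delta> < inverse (Suc n) \<and> \<not> \<bar>\<delta> * u \<delta> x - \<delta> * u \<delta> y\<bar> \<le> \<epsilon>" for n
  proof -
    have "inverse (real (Suc n)) > 0" by simp
    with * show ?thesis by meson
  qed
  then obtain \<delta> x y where \<delta>: "\<And>n. 0 < \<delta> n" "\<And>n. \<delta> n < inverse (Suc n)"
    and far: "\<And>n. \<not> \<bar>\<delta> n * u (\<delta> n) (x n) - \<delta> n * u (\<delta> n) (y n)\<bar> \<le> \<epsilon>" by metis
  obtain C where C: "\<And>n x. \<bar>\<delta> n * u (\<delta> n) x\<bar> \<le> C"
    using discounted_solutions_bounded[OF H g] u \<delta>(1) by metis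
  define f where "f n x = \<delta> n * u (\<delta> n) x" for n x
  have "\<delta> n \<le> 1" for n
  proof -
    have "inverse (real (Suc n)) \<le> 1" by (simp add: inverse_le_1_iff)
    then show ?thesis using \<delta>(2)[of n] by linarith
  qed
  then have "range f \<subseteq> {\<lambda>x. \<delta> * u \<delta> x | \<delta>. 0 < \<delta> \<and> \<delta> \<le> 1}" using \<delta>(1) unfolding f_def by auto
  then have "equicontinuous (range f)" using equi unfolding equicontinuous_def by (meson subsetD)
  moreover have "int_periodic (f n)" for n
    using discounted_solutionD(2)[OF u[OF \<delta>(1)]] unfolding f_def int_periodic_def by simp
  moreover have fC: "\<bar>f n x\<bar> \<le> C" for n x using C unfolding f_def .
  ultimately obtain w k where w: "continuous_on UNIV w" "int_periodic w"
    and k: "strict_mono (k :: nat \<Rightarrow> nat)"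
    and lim: "uniform_limit UNIV (\<lambda>n. f (k n)) w sequentially"
    using periodic_Arzela_Ascoli[of f C] by blast
  have "\<bar>w x\<bar> \<le> C" for x
  proof (rule tendsto_upperbound)
    show "(\<lambda>n. \<bar>f (k n) x\<bar>) \<longlonglongrightarrow> \<bar>w x\<bar>" by (intro tendsto_intros tendsto_uniform_limitI[OF lim]) simp
  qed (use fC in auto)
  then have "\<bar>f (k n) y - w y\<bar> \<le> 2 * C" for n y using fC[of "k n" y] by (smt (verit))
  from uniform_limit_error_bound[OF lim this]
  obtain e where e: "e \<longlonglongrightarrow> 0" "\<And>n y. \<bar>f (k n) y - w y\<bar> \<le> e n" by blast
  have "\<delta> \<longlonglongrightarrow> 0"
    by (rule Lim_null_comparison[OF _ LIMSEQ_inverse_real_of_nat])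
      (use \<delta> in \<open>auto intro!: always_eventually less_imp_le simp: abs_of_pos\<close>)
  then have "(\<lambda>n. \<delta> (k n)) \<longlonglongrightarrow> 0" using LIMSEQ_subseq_LIMSEQ[OF _ k] by (simp add: o_def)
  from discounted_limit_solution[OF H rec g(1) \<delta>(1) this u[OF \<delta>(1)] e(1) e(2)[unfolded f_def]]
  have "continuous_viscosity_solution (\<lambda>x r p. Hinf x p) w"
    unfolding continuous_viscosity_solution_def using w(1) by blast
  then obtain c where c: "w = (\<lambda>_. c)"
    using smp w(2) unfolding strong_maximum_principle_def by blast
  have "\<forall>\<^sub>F n in sequentially. e n < \<epsilon> / 2"
    by (rule order_tendstoD(2)[OF e(1)]) (use \<open>\<epsilon> > 0\<close> in simp)
  then obtain n where "e n < \<epsilon> / 2"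
    using eventually_happens'[OF sequentially_bot] by blast
  then have "\<bar>f (k n) (x (k n)) - f (k n) (y (k n))\<bar> \<le> \<epsilon>"
    using e(2)[of n "x (k n)"] e(2)[of n "y (k n)"] unfolding c by linarith
  then show False using far[of "k n"] unfolding f_def by blast
qed

text \<open>
  Once the oscillation of \<open>\<delta>u\<^sub>\<delta>\<close> vanishes, it remains to see that all limits agree. For any two
  parameters the comparison yields a point at which \<open>\<delta>u\<^sub>\<delta> \<le> \<delta>'u\<^sub>\<delta>\<^sub>'\<close>, and another one with
  the reverse inequality, so the family is Cauchy.
\<close>

lemma structural_equicontinuity_imp_ergodic:
  fixes H Hinf :: "real ^ 'n \<Rightarrow> real ^ 'n \<Rightarrow> real"
  assumes H: "hamiltonian H" and rec: "recession_function H Hinf"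
    and equi: "structural_equicontinuity H" and smp: "strong_maximum_principle Hinf"
    and g: "continuous_on UNIV g" "int_periodic g"
  shows "ergodic (\<lambda>x p. g x + H x p)"
  unfolding ergodic_def
proof (intro allI impI)
  fix u assume *: "\<forall>\<delta>>0. discounted_solution (\<lambda>x p. g x + H x p) \<delta> (u \<delta>)"
  then have u: "\<And>\<delta>. \<delta> > 0 \<Longrightarrow> discounted_solution (\<lambda>x p. g x + H x p) \<delta> (u \<delta>)" by blast
  have eq: "equicontinuous {\<lambda>x. \<delta> * u \<delta> x | \<delta>. 0 < \<delta> \<and> \<delta> \<le> 1}"
    using equi g * unfolding structural_equicontinuity_def by blast
  have close: "\<exists>\<delta>0>0. \<forall>\<delta> d x y. 0 < \<delta> \<longrightarrow> \<delta> < \<delta>0 \<longrightarrow> 0 < d \<longrightarrow> d < \<delta>0 \<longrightarrow>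
      \<bar>\<delta> * u \<delta> x - d * u d y\<bar> \<le> 2 * \<epsilon>" if "\<epsilon> > 0" for \<epsilon>
  proof -
    obtain \<delta>0 where "\<delta>0 > 0"
      and osc: "\<And>\<delta> x y. 0 < \<delta> \<Longrightarrow> \<delta> < \<delta>0 \<Longrightarrow> \<bar>\<delta> * u \<delta> x - \<delta> * u \<delta> y\<bar> \<le> \<epsilon>"
      using discounted_oscillation_vanishes[OF H rec smp g u eq \<open>\<epsilon> > 0\<close>] by blast
    have bound: "\<delta> * u \<delta> x - d * u d y \<le> 2 * \<epsilon>" if "0 < \<delta>" "\<delta> < \<delta>0" "0 < d" "d < \<delta>0" for \<delta> d x y
    proof -
      obtain z where "\<delta> * u \<delta> z \<le> d * u d z"
        using discounted_solutions_compare[OF H g(1) u[OF \<open>0 < \<delta>\<close>] u[OF \<open>0 < d\<close>]] by blast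
      then show ?thesis using osc[OF that(1,2), of x z] osc[OF that(3,4), of z y] by linarith
    qed
    have "\<bar>\<delta> * u \<delta> x - d * u d y\<bar> \<le> 2 * \<epsilon>" if "0 < \<delta>" "\<delta> < \<delta>0" "0 < d" "d < \<delta>0" for \<delta> d x y
      using bound[OF that, of x y] bound[OF that(3,4,1,2), of y x] by linarith
    then show ?thesis using \<open>\<delta>0 > 0\<close> by blast
  qed
  define s where "s n = inverse (real (Suc n)) * u (inverse (real (Suc n))) 0" for n
  have small: "\<exists>N. \<forall>n\<ge>N. 0 < inverse (real (Suc n)) \<and> inverse (real (Suc n)) < \<delta>0" if "\<delta>0 > 0" for \<delta>0
  proof -
    have "\<forall>\<^sub>F n in sequentially. inverse (real (Suc n)) < \<delta>0"
      by (rule order_tendstoD(2)[OF LIMSEQ_inverse_real_of_nat that])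
    then show ?thesis unfolding eventually_sequentially by simp
  qed
  have "Cauchy s"
  proof (rule metric_CauchyI)
    fix e :: real assume "e > 0"
    then obtain \<delta>0 where "\<delta>0 > 0" and \<delta>0: "\<And>\<delta> d x y. 0 < \<delta> \<Longrightarrow> \<delta> < \<delta>0 \<Longrightarrow> 0 < d \<Longrightarrow> d < \<delta>0 \<Longrightarrow>
        \<bar>\<delta> * u \<delta> x - d * u d y\<bar> \<le> 2 * (e / 3)"
      using close[of "e / 3"] by auto
    obtain N where N: "\<And>n. n \<ge> N \<Longrightarrow> 0 < inverse (real (Suc n)) \<and> inverse (real (Suc n)) < \<delta>0"
      using small[OF \<open>\<delta>0 > 0\<close>] by blast
    have "dist (s m) (s n) < e" if "m \<ge> N" "n \<ge> N" for m n
    proof -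
      have "\<bar>s m - s n\<bar> \<le> 2 * (e / 3)"
        unfolding s_def using N[OF that(1)] N[OF that(2)] by (intro \<delta>0) auto
      then show ?thesis using \<open>e > 0\<close> unfolding dist_real_def by linarith
    qed
    then show "\<exists>N. \<forall>m\<ge>N. \<forall>n\<ge>N. dist (s m) (s n) < e" by blast
  qed
  then obtain c where c: "s \<longlonglongrightarrow> c" using Cauchy_convergent unfolding convergent_def by blast
  have "uniform_limit UNIV (\<lambda>\<delta> x. \<delta> * u \<delta> x) (\<lambda>_. c) (at_right 0)"
  proof (rule uniform_limitI)
    fix e :: real assume "e > 0"
    then obtain \<delta>0 where "\<delta>0 > 0" and \<delta>0: "\<And>\<delta> d x y. 0 < \<delta> \<Longrightarrow> \<delta> < \<delta>0 \<Longrightarrow> 0 < d \<Longrightarrow> d < \<delta>0 \<Longrightarrow>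
        \<bar>\<delta> * u \<delta> x - d * u d y\<bar> \<le> 2 * (e / 3)"
      using close[of "e / 3"] by auto
    obtain N where N: "\<And>n. n \<ge> N \<Longrightarrow> 0 < inverse (real (Suc n)) \<and> inverse (real (Suc n)) < \<delta>0"
      using small[OF \<open>\<delta>0 > 0\<close>] by blast
    have "dist (\<delta> * u \<delta> x) c < e" if "0 < \<delta>" "\<delta> < \<delta>0" for \<delta> x
    proof -
      have "\<bar>\<delta> * u \<delta> x - c\<bar> \<le> 2 * (e / 3)"
      proof (rule tendsto_upperbound)
        show "(\<lambda>n. \<bar>\<delta> * u \<delta> x - s n\<bar>) \<longlonglongrightarrow> \<bar>\<delta> * u \<delta> x - c\<bar>" by (intro tendsto_intros c)
        have "\<bar>\<delta> * u \<delta> x - s n\<bar> \<le> 2 * (e / 3)" if "n \<ge> N" for n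
          unfolding s_def using N[OF that] \<open>0 < \<delta>\<close> \<open>\<delta> < \<delta>0\<close> by (intro \<delta>0) auto
        then show "\<forall>\<^sub>F n in sequentially. \<bar>\<delta> * u \<delta> x - s n\<bar> \<le> 2 * (e / 3)"
          unfolding eventually_sequentially by blast
      qed simp
      then show ?thesis using \<open>e > 0\<close> unfolding dist_real_def by linarith
    qed
    then show "\<forall>\<^sub>F \<delta> in at_right 0. \<forall>x\<in>UNIV. dist (\<delta> * u \<delta> x) c < e"
      unfolding eventually_at_right_field using \<open>\<delta>0 > 0\<close> by (intro exI[of _ \<delta>0]) simp
  qed
  then show "\<exists>c. uniform_limit UNIV (\<lambda>\<delta> x. \<delta> * u \<delta> x) (\<lambda>_. c) (at_right 0)" by blast
qed

theorem theorem3p2: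
  fixes H Hinf :: "real ^ 'n \<Rightarrow> real ^ 'n \<Rightarrow> real"
  assumes "hamiltonian H"
    and "recession_function H Hinf"
  shows "uniquely_ergodic H \<longleftrightarrow>
    structural_equicontinuity H \<and> strong_maximum_principle Hinf"
proof
  assume "uniquely_ergodic H"
  with assms show "structural_equicontinuity H \<and> strong_maximum_principle Hinf"
    using uniquely_ergodic_imp_structural_equicontinuity
      uniquely_ergodic_imp_strong_maximum_principle by blast
next
  assume "structural_equicontinuity H \<and> strong_maximum_principle Hinf"
  with assms show "uniquely_ergodic H"
    unfolding uniquely_ergodic_def using structural_equicontinuity_imp_ergodic by blast
qed

end
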